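(* Let $n\ge 2$, $m\ge 1$, and let $w\in W(\tilde A_n)$ be given in its canonical form $$w=h_n(j_1,i_1)\,a_{n+1}\,h_n(j_2,i_2)\,a_{n+1}\cdots h_n(j_m,i_m)\,a_{n+1}\,x,\qquad x\in W(A_n).$$ Then $w\in R_n(W(\tilde A_{n-1}))$ if and only if the following conditions hold: (1) $j_1\le n$ and $i_1<n-1$; (2) letting $s=\max\{k : 1\le k\le m\text{ and } n-k-i_k>0\}$ (the set contains $1$ when (1) holds), we have: if $s<m$, then $n-(s+1)-i_{s+1}<0$; (3) with the same $s$, $x=\lfloor n-s+1,n\rfloor\,y$ for some $y\in W(A_{n-1})$.
   Context: For $N\ge 2$, $W(\tilde A_N)$ is the affine Coxeter group with generators $\sigma_1,\dots,\sigma_N,a_{N+1}$ whose Coxeter diagram is the $(N+1)$-cycle $\sigma_1-\sigma_2-\cdots-\sigma_N-a_{N+1}-\sigma_1$ (all edges of order 3); $W(\tilde A_1)$ is the infinite dihedral group with generators $\sigma_1,a_2$. $W(A_N)$ is the parabolic subgroup generated by $\sigma_1,\dots,\sigma_N$; $W(A_{n-1})\subset W(A_n)$ is generated by $\sigma_1,\dots,\sigma_{n-1}$. $R_n:W(\tilde A_{n-1})\to W(\tilde A_n)$ is the (injective) group homomorphism with $\sigma_i\mapsto\sigma_i$ for $1\le i\le n-1$ and $a_n\mapsto\sigma_na_{n+1}\sigma_n$. Notation: $\lfloor i,j\rfloor=\sigma_i\sigma_{i+1}\cdots\sigma_j$ for $i\le j$, and $\lfloor j+1,j\rfloor=1$;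 $\lceil i,1\rceil=\sigma_i\sigma_{i-1}\cdots\sigma_1$ for $i\ge1$, and $\lceil 0,1\rceil=1$; $h_n(r,i)=\lfloor r,n\rfloor\lceil i,1\rceil$ for $0\le i\le n-1$, $1\le r\le n+1$. Canonical form: every element $w\in W(\tilde A_n)$ whose affine length (the minimal number of occurrences of $a_{n+1}$ in its reduced expressions) is $m\ge1$ is written uniquely as $h_n(j_1,i_1)a_{n+1}\cdots h_n(j_m,i_m)a_{n+1}\,x$ with $x\in W(A_n)$ and $(j_s,i_s)_{1\le s\le m}$ satisfying the pairwise inequalities: (1) $1\le j_1\le n+1$ and $0\le i_1\le n-1$; (2) for $2\le s\le m$, either $i_s=0$ and $j_s=1$, or $1\le i_s\le n-1$ and $1\le j_s\le n$; (3) for $2\le s\le m$, $j_s\le j_{s-1}$ and $i_s\ge i_{s-1}$; (4) for $2\le s\le m$, if $j_{s-1}>i_{s-1}+1$ then $j_s<j_{s-1}$; (5) for $2\le s\le m$, if $j_s>i_s+1$ then $i_s>i_{s-1}$. *)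

theory Defs
  imports "HOL-Algebra.Generated_Groups"
begin

section \<open>Coxeter groups given by a Coxeter matrix\<close>

text \<open>
  A Coxeter matrix \<open>M\<close> on a set \<open>S\<close> of generators encodes the order \<open>\<infinity>\<close> by \<open>0\<close>, so that
  the corresponding relator is the empty word. Since \<open>M s s = 1\<close> makes every generator an
  involution, the group presented by the relators \<open>(s t)^M s t\<close> is the monoid of words over \<open>S\<close>
  modulo the congruence generated by them; no formal inverses are needed.
\<close>

inductive cox_eq :: "'a set \<Rightarrow> ('a \<Rightarrow> 'a \<Rightarrow> nat) \<Rightarrow> 'a list \<Rightarrow> 'a list \<Rightarrow> bool"
  for S :: "'a set" and M :: "'a \<Rightarrow> 'a \<Rightarrow> nat"
where
  refl: "u \<in> lists S \<Longrightarrow> cox_eq S M u u"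
| sym: "cox_eq S M u v \<Longrightarrow> cox_eq S M v u"
| trans: "cox_eq S M u v \<Longrightarrow> cox_eq S M v w \<Longrightarrow> cox_eq S M u w"
| relator: "\<lbrakk>u \<in> lists S; v \<in> lists S; s \<in> S; t \<in> S\<rbrakk>
    \<Longrightarrow> cox_eq S M (u @ concat (replicate (M s t) [s, t]) @ v) (u @ v)"

definition cox_rel :: "'a set \<Rightarrow> ('a \<Rightarrow> 'a \<Rightarrow> nat) \<Rightarrow> ('a list \<times> 'a list) set" where
  "cox_rel S M = {(u, v). cox_eq S M u v}"

text \<open>
  A group element is a class of words, i.e. the set of all expressions of that element.
\<close>

definition cox_group :: "'a set \<Rightarrow> ('a \<Rightarrow> 'a \<Rightarrow> nat) \<Rightarrow> 'a list set monoid" where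
  "cox_group S M =
    \<lparr>carrier = lists S // cox_rel S M,
     mult = (\<lambda>X Y. \<Union>u\<in>X. \<Union>v\<in>Y. cox_rel S M `` {u @ v}),
     one = cox_rel S M `` {[]}\<rparr>"

definition cox_gen :: "'a set \<Rightarrow> ('a \<Rightarrow> 'a \<Rightarrow> nat) \<Rightarrow> 'a \<Rightarrow> 'a list set" where
  "cox_gen S M s = cox_rel S M `` {[s]}"

definition gprod :: "('b, 'c) monoid_scheme \<Rightarrow> 'b list \<Rightarrow> 'b" where
  "gprod G xs = foldr (mult G) xs (one G)"

text \<open>
  The homomorphism from a Coxeter group to \<open>H\<close> sending each generator \<open>s\<close> to \<open>f s\<close>. It is
  well defined when \<open>f\<close> respects the relators (\<open>cox_lift_hom\<close> below).
\<close>

definition cox_lift :: "('b, 'c) monoid_scheme \<Rightarrow> ('a \<Rightarrow> 'b) \<Rightarrow> 'a list set \<Rightarrow> 'b" where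
  "cox_lift H f X = the_elem ((\<lambda>ws. gprod H (map f ws)) ` X)"

definition reduced_exprs :: "'a list set \<Rightarrow> 'a list set" where
  "reduced_exprs w = {u \<in> w. \<forall>v\<in>w. length u \<le> length v}"


section \<open>The affine Coxeter groups of type A\<close>

text \<open>
  The nodes of the diagram of \<open>W(\<tilde>A\<^sub>n)\<close> are \<open>1, \<dots>, n + 1\<close>: node \<open>i \<le> n\<close> is \<open>\<sigma>\<^sub>i\<close> and node
  \<open>n + 1\<close> is \<open>a\<^sub>n\<^sub>+\<^sub>1\<close>. For \<open>n = 1\<close> the order of \<open>\<sigma>\<^sub>1 a\<^sub>2\<close> is infinite.
\<close>

definition affA_matrix :: "nat \<Rightarrow> nat \<Rightarrow> nat \<Rightarrow> nat" where
  "affA_matrix n s t =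
    (if s = t then 1
     else if n = 1 then 0
     else if t = s + 1 \<or> s = t + 1 \<or> {s, t} = {1, n + 1} then 3
     else 2)"

definition affA :: "nat \<Rightarrow> nat list set monoid" where
  "affA n = cox_group {1..n + 1} (affA_matrix n)"

definition sigma :: "nat \<Rightarrow> nat \<Rightarrow> nat list set" where
  "sigma n i = cox_gen {1..n + 1} (affA_matrix n) i"

definition aff_gen :: "nat \<Rightarrow> nat list set" where
  "aff_gen n = cox_gen {1..n + 1} (affA_matrix n) (n + 1)"

text \<open>\<open>finA n k\<close> is the parabolic subgroup \<open>W(A\<^sub>k)\<close> of \<open>W(\<tilde>A\<^sub>n)\<close>, for \<open>k \<le> n\<close>.\<close>

definition finA :: "nat \<Rightarrow> nat \<Rightarrow> nat list set set" where
  "finA n k = generate (affA n) (sigma n ` {1..k})"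

definition affine_length :: "nat \<Rightarrow> nat list set \<Rightarrow> nat" where
  "affine_length n w = (LEAST k. \<exists>u \<in> reduced_exprs w. k = count_list u (n + 1))"

text \<open>In \<open>W(\<tilde>A\<^sub>n\<^sub>-\<^sub>1)\<close> the node \<open>n\<close> is the affine generator \<open>a\<^sub>n\<close>.\<close>

definition R_map :: "nat \<Rightarrow> nat list set \<Rightarrow> nat list set" where
  "R_map n = cox_lift (affA n)
    (\<lambda>k. if k < n then sigma n k
         else sigma n n \<otimes>\<^bsub>affA n\<^esub> aff_gen n \<otimes>\<^bsub>affA n\<^esub> sigma n n)"

text \<open>\<open>\<lfloor>i, j\<rfloor> = \<sigma>\<^sub>i \<dots> \<sigma>\<^sub>j\<close> and \<open>\<lceil>i, 1\<rceil> = \<sigma>\<^sub>i \<dots> \<sigma>\<^sub>1\<close> in \<open>W(\<tilde>A\<^sub>n)\<close>.\<close>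

definition ascend :: "nat \<Rightarrow> nat \<Rightarrow> nat \<Rightarrow> nat list set" where
  "ascend n i j = gprod (affA n) (map (sigma n) [i..<Suc j])"

definition descend :: "nat \<Rightarrow> nat \<Rightarrow> nat list set" where
  "descend n i = gprod (affA n) (map (sigma n) (rev [1..<Suc i]))"

definition h_elt :: "nat \<Rightarrow> nat \<Rightarrow> nat \<Rightarrow> nat list set" where
  "h_elt n r i = ascend n r n \<otimes>\<^bsub>affA n\<^esub> descend n i"

definition pairwise_ineqs :: "nat \<Rightarrow> nat \<Rightarrow> (nat \<Rightarrow> nat) \<Rightarrow> (nat \<Rightarrow> nat) \<Rightarrow> bool" where
  "pairwise_ineqs n m j i \<longleftrightarrow>
    (1 \<le> j 1 \<and> j 1 \<le> n + 1 \<and> i 1 \<le> n - 1) \<and>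
    (\<forall>s\<in>{2..m}.
       (i s = 0 \<and> j s = 1 \<or> 1 \<le> i s \<and> i s \<le> n - 1 \<and> 1 \<le> j s \<and> j s \<le> n) \<and>
       (j s \<le> j (s - 1) \<and> i s \<ge> i (s - 1)) \<and>
       (j (s - 1) > i (s - 1) + 1 \<longrightarrow> j s < j (s - 1)) \<and>
       (j s > i s + 1 \<longrightarrow> i s > i (s - 1)))"

text \<open>Only the values of \<open>j\<close> and \<open>i\<close> on \<open>{1..m}\<close> matter.\<close>

definition canonical_form ::
  "nat \<Rightarrow> nat \<Rightarrow> (nat \<Rightarrow> nat) \<Rightarrow> (nat \<Rightarrow> nat) \<Rightarrow> nat list set \<Rightarrow> nat list set \<Rightarrow> bool" where
  "canonical_form n m j i x w \<longleftrightarrow>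
    w \<in> carrier (affA n) \<and> affine_length n w = m \<and>
    pairwise_ineqs n m j i \<and> x \<in> finA n n \<and>
    w = gprod (affA n) (map (\<lambda>s. h_elt n (j s) (i s) \<otimes>\<^bsub>affA n\<^esub> aff_gen n) [1..<Suc m])
          \<otimes>\<^bsub>affA n\<^esub> x"


section \<open>The groups and the homomorphism are well defined\<close>

lemma cox_eq_lists: "cox_eq S M u v \<Longrightarrow> u \<in> lists S \<and> v \<in> lists S"
  by (induction rule: cox_eq.induct) (auto simp: in_lists_conv_set)

lemma cox_rel_equiv: "equiv (lists S) (cox_rel S M)"
proof (rule equivI)
  show "cox_rel S M \<subseteq> lists S \<times> lists S"
    using cox_eq_lists unfolding cox_rel_def by blast
  show "refl_on (lists S) (cox_rel S M)"
    by (rule refl_onI) (simp_all add: cox_rel_def cox_eq.refl)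
  show "sym (cox_rel S M)"
    by (rule symI) (simp add: cox_rel_def cox_eq.sym)
  show "trans (cox_rel S M)"
    by (rule transI) (simp add: cox_rel_def, rule cox_eq.trans)
qed

lemma cox_eq_append_left: "cox_eq S M u v \<Longrightarrow> w \<in> lists S \<Longrightarrow> cox_eq S M (w @ u) (w @ v)"
proof (induction rule: cox_eq.induct)
  case (relator u v s t)
  then show ?case using cox_eq.relator[of "w @ u" S v s t M] by simp
next
  case (refl u)
  then show ?case by (intro cox_eq.refl) auto
next
  case (sym u v)
  then show ?case by (simp add: cox_eq.sym)
next
  case (trans u v v')
  then show ?case using cox_eq.trans by metis
qed

lemma cox_eq_append_right: "cox_eq S M u v \<Longrightarrow> w \<in> lists S \<Longrightarrow> cox_eq S M (u @ w) (v @ w)"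
proof (induction rule: cox_eq.induct)
  case (relator u v s t)
  then show ?case using cox_eq.relator[of u S "v @ w" s t M] by simp
next
  case (refl u)
  then show ?case by (intro cox_eq.refl) auto
next
  case (sym u v)
  then show ?case by (simp add: cox_eq.sym)
next
  case (trans u v v')
  then show ?case using cox_eq.trans by metis
qed

lemma cox_class_eq_iff:
  "u \<in> lists S \<Longrightarrow> v \<in> lists S \<Longrightarrow>
    cox_rel S M `` {u} = cox_rel S M `` {v} \<longleftrightarrow> cox_eq S M u v"
  by (metis cox_rel_def cox_rel_equiv eq_equiv_class_iff mem_Collect_eq case_prod_conv)

lemma cox_mult_class:
  assumes "u \<in> lists S" "v \<in> lists S"
  shows "cox_rel S M `` {u} \<otimes>\<^bsub>cox_group S M\<^esub> cox_rel S M `` {v} = cox_rel S M `` {u @ v}"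
proof -
  have "cox_rel S M `` {u' @ v'} = cox_rel S M `` {u @ v}"
    if "cox_eq S M u u'" "cox_eq S M v v'" for u' v'
  proof -
    have "u' \<in> lists S" "v' \<in> lists S"
      using that cox_eq_lists by blast+
    moreover have "cox_eq S M (u' @ v') (u @ v)"
      using that assms calculation
      by (meson cox_eq.sym cox_eq.trans cox_eq_append_left cox_eq_append_right)
    ultimately show ?thesis
      using assms by (subst cox_class_eq_iff) auto
  qed
  then have "cox_rel S M `` {u} \<otimes>\<^bsub>cox_group S M\<^esub> cox_rel S M `` {v} =
      (\<Union>u'\<in>cox_rel S M `` {u}. \<Union>v'\<in>cox_rel S M `` {v}. cox_rel S M `` {u @ v})"
    unfolding cox_group_def by (auto simp: cox_rel_def)
  moreover have "u \<in> cox_rel S M `` {u}" "v \<in> cox_rel S M `` {v}"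
    using assms by (auto simp: cox_rel_def intro: cox_eq.refl)
  ultimately show ?thesis by blast
qed

lemma cox_carrierE:
  assumes "X \<in> carrier (cox_group S M)"
  obtains u where "u \<in> lists S" "X = cox_rel S M `` {u}"
  using assms unfolding cox_group_def by (auto elim!: quotientE)

lemma cox_class_carrier: "u \<in> lists S \<Longrightarrow> cox_rel S M `` {u} \<in> carrier (cox_group S M)"
  by (auto simp: cox_group_def intro: quotientI)

lemma cox_one: "\<one>\<^bsub>cox_group S M\<^esub> = cox_rel S M `` {[]}"
  by (simp add: cox_group_def)

lemma cox_group_is_group:
  assumes "\<And>s. s \<in> S \<Longrightarrow> M s s = 1"
  shows "group (cox_group S M)"
proof (rule groupI)
  show "\<one>\<^bsub>cox_group S M\<^esub> \<in> carrier (cox_group S M)"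
    by (simp add: cox_one cox_class_carrier)
next
  fix X Y assume "X \<in> carrier (cox_group S M)" "Y \<in> carrier (cox_group S M)"
  then show "X \<otimes>\<^bsub>cox_group S M\<^esub> Y \<in> carrier (cox_group S M)"
    by (elim cox_carrierE) (simp add: cox_mult_class cox_class_carrier)
next
  fix X Y Z
  assume "X \<in> carrier (cox_group S M)" "Y \<in> carrier (cox_group S M)" "Z \<in> carrier (cox_group S M)"
  then show "X \<otimes>\<^bsub>cox_group S M\<^esub> Y \<otimes>\<^bsub>cox_group S M\<^esub> Z = X \<otimes>\<^bsub>cox_group S M\<^esub> (Y \<otimes>\<^bsub>cox_group S M\<^esub> Z)"
    by (elim cox_carrierE) (simp add: cox_mult_class)
next
  fix X assume "X \<in> carrier (cox_group S M)"
  then show "\<one>\<^bsub>cox_group S M\<^esub> \<otimes>\<^bsub>cox_group S M\<^esub> X = X"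
    by (elim cox_carrierE) (simp add: cox_mult_class cox_one)
next
  fix X assume "X \<in> carrier (cox_group S M)"
  then obtain u where u: "u \<in> lists S" "X = cox_rel S M `` {u}"
    by (rule cox_carrierE)
  have "cox_eq S M (rev u @ u) []"
    using u(1)
  proof (induction u)
    case (Cons s u)
    then have "s \<in> S" "u \<in> lists S" by auto
    then have "cox_eq S M (rev u @ [s, s] @ u) (rev u @ u)"
      using cox_eq.relator[of "rev u" S u s s M] assms by (simp add: in_lists_conv_set)
    with Cons \<open>u \<in> lists S\<close> show ?case
      by simp (metis cox_eq.trans)
  qed (simp add: cox_eq.refl)
  then have "cox_rel S M `` {rev u} \<otimes>\<^bsub>cox_group S M\<^esub> X = \<one>\<^bsub>cox_group S M\<^esub>"
    using u by (simp add: cox_mult_class cox_one cox_class_eq_iff in_lists_conv_set)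
  moreover have "cox_rel S M `` {rev u} \<in> carrier (cox_group S M)"
    using u by (intro cox_class_carrier) (simp add: in_lists_conv_set)
  ultimately show "\<exists>Y\<in>carrier (cox_group S M). Y \<otimes>\<^bsub>cox_group S M\<^esub> X = \<one>\<^bsub>cox_group S M\<^esub>"
    by blast
qed

lemma cox_gen_carrier: "s \<in> S \<Longrightarrow> cox_gen S M s \<in> carrier (cox_group S M)"
  by (simp add: cox_gen_def cox_class_carrier)

lemma gprod_gens:
  "u \<in> lists S \<Longrightarrow> gprod (cox_group S M) (map (cox_gen S M) u) = cox_rel S M `` {u}"
proof (induction u)
  case (Cons s u)
  then have "gprod (cox_group S M) (map (cox_gen S M) (s # u)) =
      cox_rel S M `` {[s]} \<otimes>\<^bsub>cox_group S M\<^esub> cox_rel S M `` {u}"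
    by (simp add: gprod_def cox_gen_def[of S M s])
  also have "\<dots> = cox_rel S M `` {[s] @ u}"
    using Cons by (intro cox_mult_class) auto
  finally show ?case by simp
qed (simp add: gprod_def cox_one)

context group
begin

lemma gprod_closed: "set xs \<subseteq> carrier G \<Longrightarrow> gprod G xs \<in> carrier G"
  by (induction xs) (auto simp: gprod_def)

lemma gprod_append:
  "set xs \<subseteq> carrier G \<Longrightarrow> set ys \<subseteq> carrier G \<Longrightarrow> gprod G (xs @ ys) = gprod G xs \<otimes> gprod G ys"
proof (induction xs)
  case Nil
  then show ?case using gprod_closed[of ys] by (simp add: gprod_def)
next
  case (Cons x xs)
  then show ?case
    using gprod_closed[of xs] gprod_closed[of ys] by (simp add: gprod_def m_assoc)
qed

lemma gprod_concat_replicate: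
  assumes "a \<in> carrier G" "b \<in> carrier G"
  shows "gprod G (concat (replicate k [a, b])) = (a \<otimes> b) [^] k"
proof (induction k)
  case (Suc k)
  have "gprod G (concat (replicate (Suc k) [a, b])) = (a \<otimes> b) \<otimes> (a \<otimes> b) [^] k"
    using Suc assms by (simp add: gprod_def m_assoc)
  then show ?case using assms by (metis m_closed nat_pow_Suc2)
qed (simp add: gprod_def)

lemma
  assumes f: "\<And>s. s \<in> S \<Longrightarrow> f s \<in> carrier G"
    and rel: "\<And>s t. s \<in> S \<Longrightarrow> t \<in> S \<Longrightarrow> (f s \<otimes> f t) [^] M s t = \<one>"
  shows cox_lift_class: "\<And>u. u \<in> lists S \<Longrightarrow> cox_lift G f (cox_rel S M `` {u}) = gprod G (map f u)"
    and cox_lift_gen: "\<And>s. s \<in> S \<Longrightarrow> cox_lift G f (cox_gen S M s) = f s"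
    and cox_lift_hom: "cox_lift G f \<in> hom (cox_group S M) G"
proof -
  have sub: "set (map f u) \<subseteq> carrier G" if "u \<in> lists S" for u
    using that f by auto
  have inv: "gprod G (map f u) = gprod G (map f v)" if "cox_eq S M u v" for u v
    using that
  proof (induction rule: cox_eq.induct)
    case (relator u v s t)
    have c: "set (concat (replicate k [f s, f t])) \<subseteq> carrier G" for k
      using relator f by (induction k) auto
    have "gprod G (map f (u @ concat (replicate (M s t) [s, t]) @ v)) =
        gprod G (map f u) \<otimes> (gprod G (concat (replicate (M s t) [f s, f t])) \<otimes> gprod G (map f v))"
      using c sub[OF relator(1)] sub[OF relator(2)]
      by (simp add: gprod_append map_concat del: set_concat)
    also have "\<dots> = gprod G (map f (u @ v))"
      using relator f rel sub[OF relator(1)] sub[OF relator(2)]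
      by (simp add: gprod_concat_replicate gprod_append gprod_closed)
    finally show ?case .
  qed auto
  show cls: "cox_lift G f (cox_rel S M `` {u}) = gprod G (map f u)" if "u \<in> lists S" for u
  proof -
    have "(\<lambda>ws. gprod G (map f ws)) ` (cox_rel S M `` {u}) = {gprod G (map f u)}"
      using inv that by (force simp: cox_rel_def intro: cox_eq.refl)
    then show ?thesis by (simp add: cox_lift_def)
  qed
  show "cox_lift G f (cox_gen S M s) = f s" if "s \<in> S" for s
    using that cls[of "[s]"] f by (simp add: cox_gen_def gprod_def)
  show "cox_lift G f \<in> hom (cox_group S M) G"
  proof (rule homI)
    fix X assume "X \<in> carrier (cox_group S M)"
    then show "cox_lift G f X \<in> carrier G"
      by (elim cox_carrierE) (simp only: cls gprod_closed[OF sub])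
  next
    fix X Y assume "X \<in> carrier (cox_group S M)" "Y \<in> carrier (cox_group S M)"
    then obtain u v where "u \<in> lists S" "X = cox_rel S M `` {u}" "v \<in> lists S" "Y = cox_rel S M `` {v}"
      by (auto elim!: cox_carrierE)
    then show "cox_lift G f (X \<otimes>\<^bsub>cox_group S M\<^esub> Y) = cox_lift G f X \<otimes> cox_lift G f Y"
      using sub by (simp add: cox_mult_class cls gprod_append)
  qed
qed

end

lemma cox_gen_relator:
  assumes "\<And>s. s \<in> S \<Longrightarrow> M s s = 1" "s \<in> S" "t \<in> S"
  shows "(cox_gen S M s \<otimes>\<^bsub>cox_group S M\<^esub> cox_gen S M t) [^]\<^bsub>cox_group S M\<^esub> M s t = \<one>\<^bsub>cox_group S M\<^esub>"
proof -
  interpret group "cox_group S M" using assms by (intro cox_group_is_group)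
  have "concat (replicate (M s t) [s, t]) \<in> lists S"
    using assms by (auto simp: in_lists_conv_set)
  moreover from this have "cox_eq S M (concat (replicate (M s t) [s, t])) []"
    using cox_eq.relator[of "[]" S "[]" s t M] assms by simp
  ultimately have "gprod (cox_group S M) (map (cox_gen S M) (concat (replicate (M s t) [s, t]))) = \<one>\<^bsub>cox_group S M\<^esub>"
    by (simp add: gprod_gens cox_one cox_class_eq_iff)
  then show ?thesis
    using gprod_concat_replicate[of "cox_gen S M s" "cox_gen S M t" "M s t"] assms
    by (simp add: cox_gen_carrier map_concat)
qed

lemma affA_group: "group (affA n)"
  unfolding affA_def by (rule cox_group_is_group) (simp add: affA_matrix_def)

lemma sigma_carrier: "1 \<le> i \<Longrightarrow> i \<le> n + 1 \<Longrightarrow> sigma n i \<in> carrier (affA n)"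
  by (simp add: affA_def sigma_def cox_gen_carrier)

lemma aff_gen_eq: "aff_gen n = sigma n (n + 1)"
  by (simp add: aff_gen_def sigma_def)

lemma sigma_relator:
  assumes "1 \<le> s" "s \<le> n + 1" "1 \<le> t" "t \<le> n + 1"
  shows "(sigma n s \<otimes>\<^bsub>affA n\<^esub> sigma n t) [^]\<^bsub>affA n\<^esub> affA_matrix n s t = \<one>\<^bsub>affA n\<^esub>"
  unfolding affA_def sigma_def
  by (rule cox_gen_relator) (use assms in \<open>auto simp: affA_matrix_def\<close>)

lemma (in group) pow_conj:
  assumes "g \<in> carrier G" "x \<in> carrier G" "g \<otimes> g = \<one>"
  shows "(g \<otimes> x \<otimes> g) [^] (k::nat) = g \<otimes> x [^] k \<otimes> g"
proof (induction k)
  case (Suc k)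
  have "g \<otimes> (g \<otimes> z) = z" if "z \<in> carrier G" for z
    using assms that by (metis l_one m_assoc)
  then show ?case using Suc assms by (simp add: m_assoc)
qed (use assms in simp)

lemma (in group) pow_mult_commute_one:
  assumes "x \<in> carrier G" "y \<in> carrier G" "(x \<otimes> y) [^] (k::nat) = \<one>"
  shows "(y \<otimes> x) [^] k = \<one>"
proof -
  have "x \<otimes> (y \<otimes> x) [^] k = (x \<otimes> y) [^] k \<otimes> x"
  proof (induction k)
    case (Suc k)
    have "x \<otimes> (y \<otimes> x) [^] Suc k = (x \<otimes> (y \<otimes> x) [^] k) \<otimes> (y \<otimes> x)"
      using assms by (simp add: m_assoc)
    also have "\<dots> = (x \<otimes> y) [^] Suc k \<otimes> x"
      using assms Suc by (simp add: m_assoc)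
    finally show ?case .
  qed (use assms in simp)
  then show ?thesis using assms by simp
qed

lemma R_map_relator:
  assumes "n \<ge> 2"
  defines "f \<equiv> \<lambda>k. if k < n then sigma n k
         else sigma n n \<otimes>\<^bsub>affA n\<^esub> aff_gen n \<otimes>\<^bsub>affA n\<^esub> sigma n n"
  assumes "s \<in> {1..n}" "t \<in> {1..n}"
  shows "(f s \<otimes>\<^bsub>affA n\<^esub> f t) [^]\<^bsub>affA n\<^esub> affA_matrix (n - 1) s t = \<one>\<^bsub>affA n\<^esub>"
proof -
  interpret group "affA n" by (rule affA_group)
  define g a where "g = sigma n n" and "a = aff_gen n"
  have car: "sigma n k \<in> carrier (affA n)" if "k \<in> {1..n + 1}" for k
    using that sigma_carrier by simp
  have g: "g \<in> carrier (affA n)" and a: "a \<in> carrier (affA n)"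
    using assms(1) car by (auto simp: g_def a_def aff_gen_eq)
  have sq: "sigma n k \<otimes>\<^bsub>affA n\<^esub> sigma n k = \<one>\<^bsub>affA n\<^esub>" if "k \<in> {1..n + 1}" for k
    using sigma_relator[of k n k] that car by (simp add: affA_matrix_def)
  have gg: "g \<otimes>\<^bsub>affA n\<^esub> g = \<one>\<^bsub>affA n\<^esub>" and aa: "a \<otimes>\<^bsub>affA n\<^esub> a = \<one>\<^bsub>affA n\<^esub>"
    using assms(1) sq by (auto simp: g_def a_def aff_gen_eq)
  have cancel: "x \<otimes>\<^bsub>affA n\<^esub> (x \<otimes>\<^bsub>affA n\<^esub> z) = z"
    if "x \<in> carrier (affA n)" "z \<in> carrier (affA n)" "x \<otimes>\<^bsub>affA n\<^esub> x = \<one>\<^bsub>affA n\<^esub>" for x z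
    using that by (simp flip: m_assoc)
  have inv_eq: "x = y"
    if "x \<in> carrier (affA n)" "y \<in> carrier (affA n)" "x \<otimes>\<^bsub>affA n\<^esub> y = \<one>\<^bsub>affA n\<^esub>" "y \<otimes>\<^bsub>affA n\<^esub> y = \<one>\<^bsub>affA n\<^esub>" for x y
    using that inv_equality[of x y] inv_equality[of y y] by simp
  have comm: "sigma n k \<otimes>\<^bsub>affA n\<^esub> sigma n l = sigma n l \<otimes>\<^bsub>affA n\<^esub> sigma n k"
    if "k \<in> {1..n + 1}" "l \<in> {1..n + 1}" "affA_matrix n k l = 2" for k l
  proof -
    let ?x = "sigma n k" and ?y = "sigma n l"
    have "(?x \<otimes>\<^bsub>affA n\<^esub> ?y) \<otimes>\<^bsub>affA n\<^esub> (?x \<otimes>\<^bsub>affA n\<^esub> ?y) = \<one>\<^bsub>affA n\<^esub>"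
      using sigma_relator[of k n l] that car by (simp add: numeral_2_eq_2)
    moreover have "(?x \<otimes>\<^bsub>affA n\<^esub> ?y) \<otimes>\<^bsub>affA n\<^esub> (?y \<otimes>\<^bsub>affA n\<^esub> ?x) = \<one>\<^bsub>affA n\<^esub>"
      using that car sq[of k] sq[of l] by (simp add: m_assoc cancel)
    ultimately show ?thesis
      using that car inv_unique[of "?x \<otimes>\<^bsub>affA n\<^esub> ?y" "?x \<otimes>\<^bsub>affA n\<^esub> ?y" "?y \<otimes>\<^bsub>affA n\<^esub> ?x"] by simp
  qed
  have key: "(sigma n k \<otimes>\<^bsub>affA n\<^esub> (g \<otimes>\<^bsub>affA n\<^esub> a \<otimes>\<^bsub>affA n\<^esub> g)) [^]\<^bsub>affA n\<^esub> affA_matrix (n - 1) k n = \<one>\<^bsub>affA n\<^esub>"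
    if k: "1 \<le> k" "k < n" for k
  proof -
    let ?x = "sigma n k"
    have x: "?x \<in> carrier (affA n)" using k car by simp
    consider "n = 2" | "n \<ge> 3" "k < n - 1" | "n \<ge> 3" "k = n - 1"
      using k assms(1) by linarith
    then show ?thesis
    proof cases
      case 1
      then show ?thesis using k by (simp add: affA_matrix_def)
    next
      case 2
      have "?x \<otimes>\<^bsub>affA n\<^esub> g = g \<otimes>\<^bsub>affA n\<^esub> ?x"
        unfolding g_def using 2 k by (intro comm) (auto simp: affA_matrix_def doubleton_eq_iff)
      then have "?x \<otimes>\<^bsub>affA n\<^esub> (g \<otimes>\<^bsub>affA n\<^esub> a \<otimes>\<^bsub>affA n\<^esub> g) = g \<otimes>\<^bsub>affA n\<^esub> (?x \<otimes>\<^bsub>affA n\<^esub> a) \<otimes>\<^bsub>affA n\<^esub> g"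
        using x g a by (simp flip: m_assoc)
      moreover have "affA_matrix (n - 1) k n = affA_matrix n k (n + 1)"
        using 2 k by (auto simp: affA_matrix_def doubleton_eq_iff)
      moreover have "(?x \<otimes>\<^bsub>affA n\<^esub> a) [^]\<^bsub>affA n\<^esub> affA_matrix n k (n + 1) = \<one>\<^bsub>affA n\<^esub>"
        using sigma_relator[of k n "n + 1"] k by (simp add: a_def aff_gen_eq)
      ultimately show ?thesis using x g a gg by (simp add: pow_conj)
    next
      case 3
      have "?x \<otimes>\<^bsub>affA n\<^esub> a = a \<otimes>\<^bsub>affA n\<^esub> ?x"
        unfolding a_def aff_gen_eq using 3 k by (intro comm) (auto simp: affA_matrix_def doubleton_eq_iff)
      moreover have "g \<otimes>\<^bsub>affA n\<^esub> a \<otimes>\<^bsub>affA n\<^esub> g = a \<otimes>\<^bsub>affA n\<^esub> g \<otimes>\<^bsub>affA n\<^esub> a"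
      proof (rule inv_eq)
        have "(g \<otimes>\<^bsub>affA n\<^esub> a) [^]\<^bsub>affA n\<^esub> (3::nat) = \<one>\<^bsub>affA n\<^esub>"
          using sigma_relator[of n n "n + 1"] 3 by (simp add: g_def a_def aff_gen_eq affA_matrix_def)
        then show "g \<otimes>\<^bsub>affA n\<^esub> a \<otimes>\<^bsub>affA n\<^esub> g \<otimes>\<^bsub>affA n\<^esub> (a \<otimes>\<^bsub>affA n\<^esub> g \<otimes>\<^bsub>affA n\<^esub> a) = \<one>\<^bsub>affA n\<^esub>"
          using g a by (simp add: numeral_3_eq_3 m_assoc)
        show "a \<otimes>\<^bsub>affA n\<^esub> g \<otimes>\<^bsub>affA n\<^esub> a \<otimes>\<^bsub>affA n\<^esub> (a \<otimes>\<^bsub>affA n\<^esub> g \<otimes>\<^bsub>affA n\<^esub> a) = \<one>\<^bsub>affA n\<^esub>"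
          using g a gg aa by (simp add: m_assoc cancel)
      qed (use g a in auto)
      ultimately have "?x \<otimes>\<^bsub>affA n\<^esub> (g \<otimes>\<^bsub>affA n\<^esub> a \<otimes>\<^bsub>affA n\<^esub> g) = a \<otimes>\<^bsub>affA n\<^esub> (?x \<otimes>\<^bsub>affA n\<^esub> g) \<otimes>\<^bsub>affA n\<^esub> a"
        using x g a by (simp flip: m_assoc)
      moreover have "affA_matrix (n - 1) k n = affA_matrix n k n"
        using 3 k by (auto simp: affA_matrix_def)
      moreover have "(?x \<otimes>\<^bsub>affA n\<^esub> g) [^]\<^bsub>affA n\<^esub> affA_matrix n k n = \<one>\<^bsub>affA n\<^esub>"
        using sigma_relator[of k n n] k by (simp add: g_def)
      ultimately show ?thesis using x g a aa by (simp add: pow_conj)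
    qed
  qed
  have c: "g \<otimes>\<^bsub>affA n\<^esub> a \<otimes>\<^bsub>affA n\<^esub> g \<in> carrier (affA n)" using g a by simp
  have msym: "affA_matrix (n - 1) s t = affA_matrix (n - 1) t s"
    by (simp add: affA_matrix_def doubleton_eq_iff)
  consider "s < n" "t < n" | "s = n" "t < n" | "s < n" "t = n" | "s = n" "t = n"
    using assms(3,4) by (cases "s < n"; cases "t < n") auto
  then show ?thesis
  proof cases
    case 1
    show ?thesis
    proof (cases "n = 2")
      case True
      with 1 assms(3,4) have "s = 1" "t = 1" by auto
      moreover have "f 1 = sigma n 1" "affA_matrix (n - 1) 1 1 = 1"
        using True by (simp_all add: affA_matrix_def f_def)
      ultimately show ?thesis using sq[of 1] car[of 1] by simp
    next
      case False
      then have "affA_matrix (n - 1) s t = affA_matrix n s t"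
        using 1 assms(1,3,4) by (auto simp: affA_matrix_def doubleton_eq_iff)
      then show ?thesis using 1 assms(3,4) sigma_relator[of s n t] by (simp add: f_def)
    qed
  next
    case 2
    then show ?thesis
      using pow_mult_commute_one[OF car[of t] c key[of t]] assms(4) msym
      by (simp add: f_def g_def a_def)
  next
    case 3
    then show ?thesis using key[of s] assms(3) by (simp add: f_def g_def a_def)
  next
    case 4
    have "g \<otimes>\<^bsub>affA n\<^esub> a \<otimes>\<^bsub>affA n\<^esub> g \<otimes>\<^bsub>affA n\<^esub> (g \<otimes>\<^bsub>affA n\<^esub> a \<otimes>\<^bsub>affA n\<^esub> g) = \<one>\<^bsub>affA n\<^esub>"
      using g a gg aa by (simp add: m_assoc cancel)
    then show ?thesis using 4 c by (simp add: f_def affA_matrix_def flip: g_def a_def)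
  qed
qed

lemma
  assumes "n \<ge> 2"
  shows R_map_hom: "R_map n \<in> hom (affA (n - 1)) (affA n)"
    and R_map_sigma: "\<And>i. 1 \<le> i \<Longrightarrow> i \<le> n - 1 \<Longrightarrow> R_map n (sigma (n - 1) i) = sigma n i"
    and R_map_aff_gen:
      "R_map n (aff_gen (n - 1)) = sigma n n \<otimes>\<^bsub>affA n\<^esub> aff_gen n \<otimes>\<^bsub>affA n\<^esub> sigma n n"
proof -
  let ?f = "\<lambda>k. if k < n then sigma n k
         else sigma n n \<otimes>\<^bsub>affA n\<^esub> aff_gen n \<otimes>\<^bsub>affA n\<^esub> sigma n n"
  interpret group "affA n" by (rule affA_group)
  have f: "?f s \<in> carrier (affA n)" if "s \<in> {1..n}" for s
    using that by (auto simp: aff_gen_eq intro!: m_closed sigma_carrier)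
  have n: "{1..n - 1 + 1} = {1..n}" "n - 1 + 1 = n" using assms by auto
  note rel = R_map_relator[OF assms]
  show "R_map n \<in> hom (affA (n - 1)) (affA n)"
    unfolding R_map_def affA_def[of "n - 1"] n
    by (rule cox_lift_hom) (use f rel in blast)+
  have gen: "R_map n (cox_gen {1..n} (affA_matrix (n - 1)) s) = ?f s" if "s \<in> {1..n}" for s
    unfolding R_map_def
    by (rule cox_lift_gen[where S = "{1..n}" and M = "affA_matrix (n - 1)"]) (use f rel that in blast)+
  show "R_map n (sigma (n - 1) i) = sigma n i" if "1 \<le> i" "i \<le> n - 1" for i
    unfolding sigma_def[of "n - 1"] n using gen[of i] that assms
    by (cases "i < n") auto
  show "R_map n (aff_gen (n - 1)) = sigma n n \<otimes>\<^bsub>affA n\<^esub> aff_gen n \<otimes>\<^bsub>affA n\<^esub> sigma n n"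
    unfolding aff_gen_def[of "n - 1"] n using gen[of n] assms by simp
qed

end

theory Submission
  imports Defs "HOL-Algebra.Bij"
begin

text \<open>
  \<open>W(\<tilde>A\<^sub>n)\<close> acts on the integers by affine permutations of period \<open>n + 1\<close>, and \<open>R\<^sub>n\<close> identifies
  \<open>W(\<tilde>A\<^sub>n\<^sub>-\<^sub>1)\<close> with the stabiliser of \<open>n + 1\<close>. So for \<open>w = u x\<close>, with \<open>u\<close> the product of the
  factors \<open>h\<^sub>n(j\<^sub>k, i\<^sub>k) a\<^sub>n\<^sub>+\<^sub>1\<close>, the question is whether \<open>u\<inverse>\<close> and \<open>x\<close> send \<open>n + 1\<close> to the same integer.
  As \<open>x\<close> lies in the finite group, it keeps \<open>n + 1\<close> within \<open>1, \<dots>, n + 1\<close>, and it determines the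
  representative \<open>\<lfloor>p, n\<rfloor>\<close> of its coset modulo \<open>W(A\<^sub>n\<^sub>-\<^sub>1)\<close> by the value \<open>p\<close> (\<open>finA_coset\<close>).

  The image of \<open>n + 1\<close> under \<open>u\<inverse>\<close> is found by applying the factors one after the other. If
  \<open>j\<^sub>1 \<le> n\<close> and \<open>i\<^sub>1 < n - 1\<close>, it first moves down, reaching \<open>n - k + 1\<close> after \<open>k \<le> s\<close> factors
  (\<open>track_descent\<close>). If then \<open>n < s + 1 + i\<^sub>s\<^sub>+\<^sub>1\<close>, it stays at \<open>n - s + 1\<close> for ever
  (\<open>track_plateau\<close>), so \<open>x\<close> must belong to the coset with \<open>p = n - s + 1\<close>. In the remaining case
  \<open>n = s + 1 + i\<^sub>s\<^sub>+\<^sub>1\<close> it leaves the interval \<open>1, \<dots>, n + 1\<close>, as it already does at the first factor if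
  \<open>j\<^sub>1 = n + 1\<close> or \<open>i\<^sub>1 = n - 1\<close>, and the pairwise inequalities prevent it from returning
  (\<open>track_positive_sheet\<close>, \<open>track_negative_sheet\<close>).

  That elements of the image of \<open>R\<^sub>n\<close> fix \<open>n + 1\<close> is checked on generators. The converse is read off
  from the path in the group itself: while the place stays in \<open>1, \<dots>, n + 1\<close>, it labels the coset of
  the current prefix modulo the image of \<open>R\<^sub>n\<close>, with
  representative \<open>\<lfloor>q, n\<rfloor>\<inverse>\<close> for the place \<open>q\<close>, and this follows from the braid and commutation
  relations (\<open>coset_sigma\<close>, \<open>aff_gen_ascend\<close>, \<open>canonical_prefix_coset\<close>).
\<close>

section \<open>The action on the sheets of affine permutations\<close>

text \<open>
  The affine permutation model without modular arithmetic: the integer \<open>r + (n + 1) c\<close> with residue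
  \<open>1 \<le> r \<le> n + 1\<close> is kept as the pair \<open>(r, c)\<close>. A finite generator permutes residues inside each sheet
  \<open>c\<close>; the affine generator exchanges the last place of a sheet with the first place of the next one.
\<close>

definition node_swap :: "nat \<Rightarrow> nat \<Rightarrow> nat \<times> int \<Rightarrow> nat \<times> int" where
  "node_swap n k = (\<lambda>(r, c).
    if k = n + 1 then
      (if r = n + 1 then (1, c + 1) else if r = 1 then (n + 1, c - 1) else (r, c))
    else if r = k then (k + 1, c) else if r = k + 1 then (k, c) else (r, c))"

lemma node_swap_pair:
  "node_swap n k (r, c) =
    (if k = n + 1 then
      (if r = n + 1 then (1, c + 1) else if r = 1 then (n + 1, c - 1) else (r, c))
    else if r = k then (k + 1, c) else if r = k + 1 then (k, c) else (r, c))"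
  by (simp add: node_swap_def)

lemma node_swap_involution: "n \<ge> 1 \<Longrightarrow> node_swap n k (node_swap n k z) = z"
  by (cases z) (auto simp: node_swap_pair)

lemma node_swap_Bij: "n \<ge> 1 \<Longrightarrow> node_swap n k \<in> Bij UNIV"
  unfolding Bij_def using node_swap_involution[of n k]
  by (auto simp: extensional_def fun_eq_iff intro!: o_bij[of "node_swap n k"])

lemma BijGroup_UNIV_mult:
  "f \<in> carrier (BijGroup UNIV) \<Longrightarrow> g \<in> carrier (BijGroup UNIV) \<Longrightarrow>
    f \<otimes>\<^bsub>BijGroup UNIV\<^esub> g = f \<circ> g"
  by (simp add: BijGroup_def compose_def fun_eq_iff)

lemma BijGroup_UNIV_pow:
  assumes "f \<in> carrier (BijGroup UNIV)"
  shows "f [^]\<^bsub>BijGroup UNIV\<^esub> (k :: nat) = f ^^ k"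
proof -
  interpret group "BijGroup UNIV" by (rule group_BijGroup)
  show ?thesis
  proof (induction k)
    case 0
    then show ?case by (simp add: BijGroup_def fun_eq_iff)
  next
    case (Suc k)
    have "f [^]\<^bsub>BijGroup UNIV\<^esub> Suc k = (f [^]\<^bsub>BijGroup UNIV\<^esub> k) \<circ> f"
      using assms by (simp add: BijGroup_UNIV_mult)
    then show ?case using Suc.IH by (simp only: funpow_Suc_right)
  qed
qed

lemma node_swap_relator:
  assumes "n \<ge> 2" "s \<in> {1..n + 1}" "t \<in> {1..n + 1}"
  shows "(node_swap n s \<otimes>\<^bsub>BijGroup UNIV\<^esub> node_swap n t) [^]\<^bsub>BijGroup UNIV\<^esub> affA_matrix n s t
    = \<one>\<^bsub>BijGroup UNIV\<^esub>"
proof -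
  interpret B: group "BijGroup (UNIV :: (nat \<times> int) set)" by (rule group_BijGroup)
  let ?f = "node_swap n s \<circ> node_swap n t"
  have carr: "node_swap n k \<in> carrier (BijGroup UNIV)" for k
    using assms(1) node_swap_Bij[of n k] by (simp add: BijGroup_def)
  have mult: "node_swap n s \<otimes>\<^bsub>BijGroup UNIV\<^esub> node_swap n t = ?f"
    by (intro BijGroup_UNIV_mult carr)
  then have f: "?f \<in> carrier (BijGroup UNIV)"
    using B.m_closed[OF carr carr] by metis
  have "(?f ^^ affA_matrix n s t) (r, c) = (r, c)" for r c
    using assms unfolding affA_matrix_def
    by (auto simp: node_swap_pair numeral_3_eq_3 numeral_2_eq_2 doubleton_eq_iff)
  then have "?f ^^ affA_matrix n s t = (\<lambda>z\<in>UNIV. z)"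
    by (auto simp: fun_eq_iff)
  then show ?thesis
    unfolding mult BijGroup_UNIV_pow[OF f] by (simp add: BijGroup_def)
qed

definition act :: "nat \<Rightarrow> nat list set \<Rightarrow> nat \<times> int \<Rightarrow> nat \<times> int" where
  "act n = cox_lift (BijGroup UNIV) (node_swap n)"

lemma
  assumes "n \<ge> 2"
  shows act_hom: "act n \<in> hom (affA n) (BijGroup UNIV)"
    and act_sigma: "\<And>k. 1 \<le> k \<Longrightarrow> k \<le> n + 1 \<Longrightarrow> act n (sigma n k) = node_swap n k"
proof -
  interpret B: group "BijGroup (UNIV :: (nat \<times> int) set)" by (rule group_BijGroup)
  have carr: "node_swap n k \<in> carrier (BijGroup UNIV)" for k
    using assms node_swap_Bij[of n k] by (simp add: BijGroup_def)
  show "act n \<in> hom (affA n) (BijGroup UNIV)"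
    unfolding act_def affA_def
    by (rule B.cox_lift_hom) (use carr node_swap_relator[OF assms] in blast)+
  show "act n (sigma n k) = node_swap n k" if "1 \<le> k" "k \<le> n + 1" for k
    unfolding act_def sigma_def
    by (rule B.cox_lift_gen[where S = "{1..n + 1}" and M = "affA_matrix n"])
      (use that carr node_swap_relator[OF assms] in auto)
qed

lemma act_mult:
  assumes "n \<ge> 2" "g \<in> carrier (affA n)" "h \<in> carrier (affA n)"
  shows "act n (g \<otimes>\<^bsub>affA n\<^esub> h) z = act n g (act n h z)"
  using act_hom[OF assms(1)] assms(2,3)
  by (simp add: hom_mult hom_in_carrier BijGroup_UNIV_mult)

lemma act_one: "n \<ge> 2 \<Longrightarrow> act n \<one>\<^bsub>affA n\<^esub> z = z"
  using hom_one[OF act_hom affA_group group_BijGroup, of n] by (simp add: BijGroup_def)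

lemma act_inv_act:
  assumes "n \<ge> 2" "g \<in> carrier (affA n)"
  shows "act n (inv\<^bsub>affA n\<^esub> g) (act n g z) = z"
proof -
  interpret group "affA n" by (rule affA_group)
  show ?thesis using assms by (simp add: act_one flip: act_mult)
qed

text \<open>
  Every generator is an involution, so left multiplication by generators alone, without inverses,
  reaches every element.
\<close>

lemma affA_induct [consumes 1, case_names one mult]:
  assumes "X \<in> carrier (affA n)"
    and one: "P \<one>\<^bsub>affA n\<^esub>"
    and mult: "\<And>k X. \<lbrakk>1 \<le> k; k \<le> n + 1; X \<in> carrier (affA n); P X\<rbrakk> \<Longrightarrow> P (sigma n k \<otimes>\<^bsub>affA n\<^esub> X)"
  shows "P X"
proof -
  interpret group "affA n" by (rule affA_group)
  obtain u where u: "u \<in> lists {1..n + 1}" "X = cox_rel {1..n + 1} (affA_matrix n) `` {u}"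
    using assms(1) unfolding affA_def by (rule cox_carrierE)
  have "P (gprod (affA n) (map (sigma n) u))"
    using u(1)
  proof (induction u)
    case (Cons k u)
    then have "set (map (sigma n) u) \<subseteq> carrier (affA n)"
      by (auto intro: sigma_carrier)
    then show ?case
      using Cons mult[of k "gprod (affA n) (map (sigma n) u)"] gprod_closed
      by (auto simp: gprod_def)
  qed (simp add: gprod_def one)
  moreover have "gprod (affA n) (map (sigma n) u) = X"
    using gprod_gens[OF u(1), of "affA_matrix n"] u(2)
    by (simp add: affA_def sigma_def[abs_def])
  ultimately show ?thesis by simp
qed

section \<open>Coset representatives for the stabiliser of a place\<close>

lemma finA_subgroup: "k \<le> n + 1 \<Longrightarrow> subgroup (finA n k) (affA n)"
  unfolding finA_def
  by (rule group.generate_is_subgroup[OF affA_group]) (auto intro: sigma_carrier)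

lemma sigma_in_finA: "1 \<le> l \<Longrightarrow> l \<le> k \<Longrightarrow> sigma n l \<in> finA n k"
  unfolding finA_def by (auto intro: generate.incl)

lemma gprod_in_subgroup:
  "subgroup K G \<Longrightarrow> set xs \<subseteq> K \<Longrightarrow> gprod G xs \<in> K"
  by (induction xs) (auto simp: gprod_def subgroup.one_closed subgroup.m_closed)

lemma sigma_square:
  assumes "1 \<le> k" "k \<le> n + 1"
  shows "sigma n k \<otimes>\<^bsub>affA n\<^esub> sigma n k = \<one>\<^bsub>affA n\<^esub>"
proof -
  interpret group "affA n" by (rule affA_group)
  show ?thesis using assms sigma_relator[of k n k] sigma_carrier[of k n]
    by (simp add: affA_matrix_def)
qed

lemma sigma_inv: "1 \<le> k \<Longrightarrow> k \<le> n + 1 \<Longrightarrow> inv\<^bsub>affA n\<^esub> (sigma n k) = sigma n k"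
  using group.inv_equality[OF affA_group sigma_square] sigma_carrier by simp

lemma sigma_cancel:
  assumes "1 \<le> k" "k \<le> n + 1" "g \<in> carrier (affA n)"
  shows "sigma n k \<otimes>\<^bsub>affA n\<^esub> (sigma n k \<otimes>\<^bsub>affA n\<^esub> g) = g"
proof -
  interpret group "affA n" by (rule affA_group)
  show ?thesis using assms by (simp add: sigma_carrier sigma_square flip: m_assoc)
qed

lemma sigma_commute:
  assumes "k \<in> {1..n + 1}" "l \<in> {1..n + 1}" "affA_matrix n k l = 2"
  shows "sigma n k \<otimes>\<^bsub>affA n\<^esub> sigma n l = sigma n l \<otimes>\<^bsub>affA n\<^esub> sigma n k"
proof -
  interpret group "affA n" by (rule affA_group)
  let ?p = "sigma n k \<otimes>\<^bsub>affA n\<^esub> sigma n l"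
  have car: "sigma n k \<in> carrier (affA n)" "sigma n l \<in> carrier (affA n)"
    using assms sigma_carrier by auto
  then have "?p \<otimes>\<^bsub>affA n\<^esub> ?p = \<one>\<^bsub>affA n\<^esub>"
    using sigma_relator[of k n l] assms by (simp add: numeral_2_eq_2)
  then have "inv\<^bsub>affA n\<^esub> ?p = ?p"
    using car by (simp add: inv_equality)
  then show ?thesis
    using car assms by (simp add: inv_mult_group sigma_inv)
qed

lemma sigma_braid:
  assumes "k \<in> {1..n + 1}" "l \<in> {1..n + 1}" "affA_matrix n k l = 3"
  shows "sigma n k \<otimes>\<^bsub>affA n\<^esub> (sigma n l \<otimes>\<^bsub>affA n\<^esub> sigma n k)
    = sigma n l \<otimes>\<^bsub>affA n\<^esub> (sigma n k \<otimes>\<^bsub>affA n\<^esub> sigma n l)"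
proof -
  interpret group "affA n" by (rule affA_group)
  let ?x = "sigma n k" and ?y = "sigma n l"
  let ?p = "?x \<otimes>\<^bsub>affA n\<^esub> (?y \<otimes>\<^bsub>affA n\<^esub> ?x)" and ?q = "?y \<otimes>\<^bsub>affA n\<^esub> (?x \<otimes>\<^bsub>affA n\<^esub> ?y)"
  have car: "?x \<in> carrier (affA n)" "?y \<in> carrier (affA n)"
    using assms sigma_carrier by auto
  then have "?p \<otimes>\<^bsub>affA n\<^esub> ?q = \<one>\<^bsub>affA n\<^esub>"
    using sigma_relator[of k n l] assms by (simp add: numeral_3_eq_3 m_assoc)
  then have "inv\<^bsub>affA n\<^esub> ?q = ?p"
    using car by (simp add: inv_equality)
  then show ?thesis
    using car assms by (simp add: inv_mult_group sigma_inv m_assoc)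
qed

lemma (in group) commute_gprod:
  assumes "g \<in> carrier G" "set xs \<subseteq> carrier G" "\<And>x. x \<in> set xs \<Longrightarrow> g \<otimes> x = x \<otimes> g"
  shows "g \<otimes> gprod G xs = gprod G xs \<otimes> g"
  using assms(2,3)
proof (induction xs)
  case (Cons x xs)
  have IH: "g \<otimes> gprod G xs = gprod G xs \<otimes> g" using Cons by simp
  have car: "x \<in> carrier G" "gprod G xs \<in> carrier G" using Cons gprod_closed[of xs] by auto
  have "g \<otimes> (x \<otimes> gprod G xs) = (x \<otimes> g) \<otimes> gprod G xs"
    using Cons.prems(2)[of x] car assms(1) by (simp flip: m_assoc)
  also have "\<dots> = (x \<otimes> gprod G xs) \<otimes> g"
    using IH car assms(1) by (simp add: m_assoc)
  finally show ?case by (simp add: gprod_def)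
qed (use assms in \<open>simp add: gprod_def\<close>)

lemma ascend_closed: "1 \<le> p \<Longrightarrow> l \<le> n + 1 \<Longrightarrow> ascend n p l \<in> carrier (affA n)"
  unfolding ascend_def
  by (rule group.gprod_closed[OF affA_group]) (auto intro: sigma_carrier)

lemma ascend_Cons: "p \<le> l \<Longrightarrow> ascend n p l = sigma n p \<otimes>\<^bsub>affA n\<^esub> ascend n (Suc p) l"
  by (simp add: ascend_def gprod_def upt_conv_Cons del: upt_Suc)

lemma ascend_empty: "l < p \<Longrightarrow> ascend n p l = \<one>\<^bsub>affA n\<^esub>"
  by (simp add: ascend_def gprod_def)

lemma sigma_ascend_commute:
  assumes "1 \<le> l" "l + 1 < q" "q \<le> n + 1"
  shows "sigma n l \<otimes>\<^bsub>affA n\<^esub> ascend n q n = ascend n q n \<otimes>\<^bsub>affA n\<^esub> sigma n l"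
  unfolding ascend_def
proof (rule group.commute_gprod[OF affA_group])
  show "sigma n l \<in> carrier (affA n)" "set (map (sigma n) [q..<Suc n]) \<subseteq> carrier (affA n)"
    using assms by (auto intro: sigma_carrier)
  fix x assume "x \<in> set (map (sigma n) [q..<Suc n])"
  then obtain t where "x = sigma n t" "q \<le> t" "t \<le> n" by auto
  then show "sigma n l \<otimes>\<^bsub>affA n\<^esub> x = x \<otimes>\<^bsub>affA n\<^esub> sigma n l"
    using assms sigma_commute[of l n t] by (simp add: affA_matrix_def doubleton_eq_iff)
qed

text \<open>
  Conjugation by the cycle \<open>\<sigma>\<^sub>q \<dots> \<sigma>\<^sub>n\<close> lowers the index by one: the braid relation does this at the
  two letters \<open>\<sigma>\<^sub>l\<^sub>-\<^sub>1 \<sigma>\<^sub>l\<close>, while \<open>\<sigma>\<^sub>l\<close> commutes with the letters before them and \<open>\<sigma>\<^sub>l\<^sub>-\<^sub>1\<close> with those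
  after them.
\<close>

lemma sigma_ascend_shift:
  assumes "1 \<le> q" "q < l" "l \<le> n"
  shows "sigma n l \<otimes>\<^bsub>affA n\<^esub> ascend n q n = ascend n q n \<otimes>\<^bsub>affA n\<^esub> sigma n (l - 1)"
  using assms
proof (induction "l - q" arbitrary: q)
  case 0
  then show ?case by simp
next
  case (Suc d)
  interpret group "affA n" by (rule affA_group)
  note car = sigma_carrier[of _ n] ascend_closed[of _ n n]
  show ?case
  proof (cases "l = Suc q")
    case True
    let ?A = "ascend n (Suc (Suc q)) n"
    have split: "ascend n q n = sigma n q \<otimes>\<^bsub>affA n\<^esub> (sigma n l \<otimes>\<^bsub>affA n\<^esub> ?A)"
      using True Suc.prems by (simp add: ascend_Cons)
    have "sigma n l \<otimes>\<^bsub>affA n\<^esub> (sigma n q \<otimes>\<^bsub>affA n\<^esub> sigma n l)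
        = sigma n q \<otimes>\<^bsub>affA n\<^esub> (sigma n l \<otimes>\<^bsub>affA n\<^esub> sigma n q)"
      using True Suc.prems by (intro sigma_braid) (auto simp: affA_matrix_def)
    then have "sigma n l \<otimes>\<^bsub>affA n\<^esub> ascend n q n
        = sigma n q \<otimes>\<^bsub>affA n\<^esub> (sigma n l \<otimes>\<^bsub>affA n\<^esub> (sigma n q \<otimes>\<^bsub>affA n\<^esub> ?A))"
      unfolding split using True Suc.prems car by (simp flip: m_assoc)
    also have "sigma n q \<otimes>\<^bsub>affA n\<^esub> ?A = ?A \<otimes>\<^bsub>affA n\<^esub> sigma n q"
      using True Suc.prems by (intro sigma_ascend_commute) auto
    finally show ?thesis
      unfolding split using True Suc.prems car by (simp add: m_assoc)
  next
    case False
    let ?A = "ascend n (Suc q) n"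
    have split: "ascend n q n = sigma n q \<otimes>\<^bsub>affA n\<^esub> ?A"
      using Suc.prems by (simp add: ascend_Cons)
    have IH: "sigma n l \<otimes>\<^bsub>affA n\<^esub> ?A = ?A \<otimes>\<^bsub>affA n\<^esub> sigma n (l - 1)"
      using False Suc by (intro Suc.hyps(1)) auto
    have "sigma n l \<otimes>\<^bsub>affA n\<^esub> sigma n q = sigma n q \<otimes>\<^bsub>affA n\<^esub> sigma n l"
      using False Suc.prems by (intro sigma_commute) (auto simp: affA_matrix_def doubleton_eq_iff)
    then have "sigma n l \<otimes>\<^bsub>affA n\<^esub> ascend n q n
        = sigma n q \<otimes>\<^bsub>affA n\<^esub> (sigma n l \<otimes>\<^bsub>affA n\<^esub> ?A)"
      unfolding split using Suc.prems car by (simp flip: m_assoc)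
    then show ?thesis
      unfolding split IH using Suc.prems car by (simp add: m_assoc)
  qed
qed

text \<open>
  The left factor \<open>g\<close> stands for the coset \<open>K g\<close>, and the hypothesis on \<open>g\<close> says that this coset is
  the one labelled by the place \<open>q\<close>, with representative \<open>(\<sigma>\<^sub>q \<dots> \<sigma>\<^sub>n)\<inverse>\<close>. Right multiplication by
  \<open>\<sigma>\<^sub>l\<close> moves the label as the transposition of \<open>l\<close> and \<open>l + 1\<close> does: for \<open>l = q\<close> and \<open>l = q - 1\<close> the
  representative gets shorter or longer by one letter, and otherwise \<open>\<sigma>\<^sub>l\<close> passes through it and
  becomes a generator that lies in \<open>K\<close>.
\<close>

lemma coset_sigma:
  assumes K: "subgroup K (affA n)" "sigma n ` {1..n - 1} \<subseteq> K"
    and g: "g \<in> carrier (affA n)" and l: "1 \<le> l" "l \<le> n" and q: "1 \<le> q" "q \<le> n + 1"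
    and gK: "g \<otimes>\<^bsub>affA n\<^esub> ascend n q n \<in> K"
  shows "g \<otimes>\<^bsub>affA n\<^esub> sigma n l \<otimes>\<^bsub>affA n\<^esub> ascend n (fst (node_swap n l (q, c))) n \<in> K"
proof -
  interpret group "affA n" by (rule affA_group)
  note car = sigma_carrier[of _ n] ascend_closed[of _ n n] g
  have in_K: "sigma n t \<in> K" if "1 \<le> t" "t < n" for t
    using K(2) that by auto
  have mul: "g \<otimes>\<^bsub>affA n\<^esub> sigma n l \<otimes>\<^bsub>affA n\<^esub> A \<in> K"
    if "sigma n l \<otimes>\<^bsub>affA n\<^esub> A = ascend n q n \<otimes>\<^bsub>affA n\<^esub> sigma n t" "1 \<le> t" "t < n"
      "A \<in> carrier (affA n)" for A t
  proof -
    have "g \<otimes>\<^bsub>affA n\<^esub> sigma n l \<otimes>\<^bsub>affA n\<^esub> A = g \<otimes>\<^bsub>affA n\<^esub> ascend n q n \<otimes>\<^bsub>affA n\<^esub> sigma n t"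
      using that car l q by (simp add: m_assoc)
    then show ?thesis
      using subgroup.m_closed[OF K(1) gK in_K] that by simp
  qed
  consider "l = q" | "l + 1 = q" | "l > q" | "l + 1 < q" by linarith
  then show ?thesis
  proof cases
    case 1
    then have "fst (node_swap n l (q, c)) = Suc q" "ascend n q n = sigma n l \<otimes>\<^bsub>affA n\<^esub> ascend n (Suc q) n"
      using l by (auto simp: node_swap_pair ascend_Cons)
    then show ?thesis using gK car l q 1 by (simp add: m_assoc)
  next
    case 2
    then have "fst (node_swap n l (q, c)) = l" "ascend n l n = sigma n l \<otimes>\<^bsub>affA n\<^esub> ascend n q n"
      using l by (auto simp: node_swap_pair ascend_Cons)
    then show ?thesis using gK car l q 2 by (simp add: m_assoc sigma_cancel)
  next
    case 3
    then have "fst (node_swap n l (q, c)) = q" using l by (simp add: node_swap_pair)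
    then show ?thesis
      using mul[OF sigma_ascend_shift[of q l n]] 3 l q car by simp
  next
    case 4
    then have "fst (node_swap n l (q, c)) = q" using l by (simp add: node_swap_pair)
    then show ?thesis
      using mul[OF sigma_ascend_commute[of l q n]] 4 l q car by simp
  qed
qed

text \<open>
  Away from the two ends of a sheet the affine generator also passes through the representative,
  and comes out as the image of \<open>a\<^sub>n\<close> under \<open>R\<^sub>n\<close>. So it fixes these cosets of the image of \<open>R\<^sub>n\<close>,
  just as it fixes the places \<open>2, \<dots>, n\<close>.
\<close>

lemma aff_gen_ascend:
  assumes "2 \<le> q" "q \<le> n"
  shows "aff_gen n \<otimes>\<^bsub>affA n\<^esub> ascend n q n
    = ascend n q n \<otimes>\<^bsub>affA n\<^esub> (sigma n n \<otimes>\<^bsub>affA n\<^esub> aff_gen n \<otimes>\<^bsub>affA n\<^esub> sigma n n)"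
proof -
  interpret group "affA n" by (rule affA_group)
  let ?B = "gprod (affA n) (map (sigma n) [q..<n])"
  have set: "set (map (sigma n) [q..<n]) \<subseteq> carrier (affA n)"
    using assms by (auto intro: sigma_carrier)
  have B: "?B \<in> carrier (affA n)" using gprod_closed[OF set] .
  have a: "aff_gen n \<in> carrier (affA n)" and s: "sigma n n \<in> carrier (affA n)"
    using assms by (auto simp: aff_gen_eq intro: sigma_carrier)
  have "gprod (affA n) [sigma n n] = sigma n n"
    using s by (simp add: gprod_def)
  then have split: "ascend n q n = ?B \<otimes>\<^bsub>affA n\<^esub> sigma n n"
    using gprod_append[OF set, of "[sigma n n]"] assms s by (simp add: ascend_def)
  have "aff_gen n \<otimes>\<^bsub>affA n\<^esub> ?B = ?B \<otimes>\<^bsub>affA n\<^esub> aff_gen n"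
  proof (rule commute_gprod[OF a set])
    fix x assume "x \<in> set (map (sigma n) [q..<n])"
    then obtain t where "x = sigma n t" "q \<le> t" "t < n" by auto
    then show "aff_gen n \<otimes>\<^bsub>affA n\<^esub> x = x \<otimes>\<^bsub>affA n\<^esub> aff_gen n"
      unfolding aff_gen_eq using assms sigma_commute[of "n + 1" n t]
      by (simp add: affA_matrix_def doubleton_eq_iff)
  qed
  then have "aff_gen n \<otimes>\<^bsub>affA n\<^esub> ascend n q n = ?B \<otimes>\<^bsub>affA n\<^esub> (aff_gen n \<otimes>\<^bsub>affA n\<^esub> sigma n n)"
    unfolding split using a s B by (simp flip: m_assoc)
  then show ?thesis
    unfolding split using a s B assms by (simp add: m_assoc sigma_cancel)
qed

text \<open>
  The label of a coset follows the action of the whole finite group. Multiplying on the right by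
  \<open>x\<inverse>\<close> moves the label by \<open>x\<close> itself, because \<open>K g\<close> is labelled by the place to which \<open>g\<inverse>\<close>
  sends \<open>n + 1\<close>.
\<close>

lemma coset_finA:
  assumes n: "n \<ge> 2"
    and K: "subgroup K (affA n)" "sigma n ` {1..n - 1} \<subseteq> K"
    and x: "x \<in> finA n n"
    and g: "g \<in> carrier (affA n)" and q: "1 \<le> q" "q \<le> n + 1"
    and gK: "g \<otimes>\<^bsub>affA n\<^esub> ascend n q n \<in> K"
  obtains q' where "act n x (q, c) = (q', c)" "1 \<le> q'" "q' \<le> n + 1"
    "g \<otimes>\<^bsub>affA n\<^esub> inv\<^bsub>affA n\<^esub> x \<otimes>\<^bsub>affA n\<^esub> ascend n q' n \<in> K"
proof -
  interpret group "affA n" by (rule affA_group)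
  have gen: "\<exists>q'. act n s (q, c) = (q', c) \<and> 1 \<le> q' \<and> q' \<le> n + 1 \<and>
      g \<otimes>\<^bsub>affA n\<^esub> inv\<^bsub>affA n\<^esub> s \<otimes>\<^bsub>affA n\<^esub> ascend n q' n \<in> K"
    if "s \<in> sigma n ` {1..n}" "g \<in> carrier (affA n)" "1 \<le> q" "q \<le> n + 1"
      "g \<otimes>\<^bsub>affA n\<^esub> ascend n q n \<in> K" for s g q
  proof -
    from that(1) obtain l where l: "s = sigma n l" "1 \<le> l" "l \<le> n" by auto
    have "act n s (q, c) = (fst (node_swap n l (q, c)), c)" "1 \<le> fst (node_swap n l (q, c))"
      "fst (node_swap n l (q, c)) \<le> n + 1"
      using l n that by (auto simp: act_sigma node_swap_pair)
    then show ?thesis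
      using coset_sigma[OF K that(2) l(2,3) that(3-5), of c] l by (simp add: sigma_inv)
  qed
  have "\<exists>q'. act n x (q, c) = (q', c) \<and> 1 \<le> q' \<and> q' \<le> n + 1 \<and>
      g \<otimes>\<^bsub>affA n\<^esub> inv\<^bsub>affA n\<^esub> x \<otimes>\<^bsub>affA n\<^esub> ascend n q' n \<in> K"
    using x g q gK unfolding finA_def
  proof (induction x arbitrary: g q rule: generate.induct)
    case one
    then show ?case using n by (simp add: act_one)
  next
    case (incl s)
    then show ?case by (rule gen)
  next
    case (inv s)
    then have "inv\<^bsub>affA n\<^esub> s = s" using sigma_inv by auto
    then show ?case using gen[OF inv] by simp
  next
    case (eng x y)
    have "sigma n ` {1..n} \<subseteq> carrier (affA n)"
      by (auto intro: sigma_carrier)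
    then have car: "x \<in> carrier (affA n)" "y \<in> carrier (affA n)"
      using eng.hyps generate_in_carrier by blast+
    obtain q' where q': "act n y (q, c) = (q', c)" "1 \<le> q'" "q' \<le> n + 1"
        "g \<otimes>\<^bsub>affA n\<^esub> inv\<^bsub>affA n\<^esub> y \<otimes>\<^bsub>affA n\<^esub> ascend n q' n \<in> K"
      using eng.IH(2) eng.prems by blast
    moreover have "g \<otimes>\<^bsub>affA n\<^esub> inv\<^bsub>affA n\<^esub> y \<in> carrier (affA n)"
      using car eng.prems by simp
    ultimately obtain q'' where "act n x (q', c) = (q'', c)" "1 \<le> q''" "q'' \<le> n + 1"
        "g \<otimes>\<^bsub>affA n\<^esub> inv\<^bsub>affA n\<^esub> y \<otimes>\<^bsub>affA n\<^esub> inv\<^bsub>affA n\<^esub> x \<otimes>\<^bsub>affA n\<^esub> ascend n q'' n \<in> K"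
      using eng.IH(1) by blast
    then show ?case
      using n car q'(1) eng.prems by (auto simp: act_mult inv_mult_group m_assoc)
  qed
  then show thesis using that by blast
qed

section \<open>The move of a place under one factor of the canonical form\<close>

lemma act_inv_gprod:
  assumes "n \<ge> 2" "set ks \<subseteq> {1..n + 1}"
  shows "act n (inv\<^bsub>affA n\<^esub> gprod (affA n) (map (sigma n) ks)) z = fold (node_swap n) ks z"
  using assms(2)
proof (induction ks arbitrary: z)
  case Nil
  interpret group "affA n" by (rule affA_group)
  show ?case using assms(1) by (simp add: gprod_def act_one)
next
  case (Cons k ks)
  interpret group "affA n" by (rule affA_group)
  have "set (map (sigma n) ks) \<subseteq> carrier (affA n)"
    using Cons.prems by (auto simp: subset_iff intro!: sigma_carrier)
  then have car: "gprod (affA n) (map (sigma n) ks) \<in> carrier (affA n)" "sigma n k \<in> carrier (affA n)"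
    using Cons.prems gprod_closed by (auto intro: sigma_carrier)
  then have "inv\<^bsub>affA n\<^esub> gprod (affA n) (map (sigma n) (k # ks))
      = inv\<^bsub>affA n\<^esub> gprod (affA n) (map (sigma n) ks) \<otimes>\<^bsub>affA n\<^esub> sigma n k"
    using Cons.prems by (simp add: gprod_def inv_mult_group sigma_inv)
  then show ?case
    using Cons car assms(1) by (simp add: act_mult act_sigma)
qed

lemma fold_node_swap_up:
  "1 \<le> p \<Longrightarrow> l \<le> n \<Longrightarrow> fold (node_swap n) [p..<Suc l] (r, c) =
    (if p \<le> r \<and> r \<le> Suc l then if r = p then (Suc l, c) else (r - 1, c) else (r, c))"
proof (induction l)
  case 0
  then show ?case by auto
next
  case (Suc l)
  then show ?case
    by (auto simp: node_swap_pair le_Suc_eq)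
qed

lemma fold_node_swap_down:
  "i \<le> n \<Longrightarrow> 1 \<le> r \<Longrightarrow> fold (node_swap n) (rev [1..<Suc i]) (r, c) =
    (if r = i + 1 then (1, c) else if r \<le> i then (r + 1, c) else (r, c))"
proof (induction i arbitrary: r)
  case 0
  then show ?case by auto
next
  case (Suc i)
  have "fold (node_swap n) (rev [1..<Suc (Suc i)]) (r, c)
      = fold (node_swap n) (rev [1..<Suc i]) (node_swap n (Suc i) (r, c))"
    by simp
  then show ?case
    using Suc.prems by (auto simp: Suc.IH node_swap_pair simp del: upt_Suc One_nat_def)
qed

text \<open>
  What the inverse of \<open>\<lfloor>p, n\<rfloor> \<lceil>i, 1\<rceil> a\<^sub>n\<^sub>+\<^sub>1\<close> does to a place: the cycle of \<open>\<lfloor>p, n\<rfloor>\<close> sends \<open>p\<close> to the end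
  of the sheet, the cycle of \<open>\<lceil>i, 1\<rceil>\<close> sends \<open>i + 1\<close> to its beginning, and \<open>a\<^sub>n\<^sub>+\<^sub>1\<close> carries these two
  ends over to the neighbouring sheets.
\<close>

definition factor_move :: "nat \<Rightarrow> nat \<Rightarrow> nat \<Rightarrow> nat \<times> int \<Rightarrow> nat \<times> int" where
  "factor_move n p i = (\<lambda>(r, c).
    let r' = (if r < p then r else if r = p then n + 1 else r - 1);
        r'' = (if r' = i + 1 then 1 else if r' \<le> i then r' + 1 else r')
    in node_swap n (n + 1) (r'', c))"

lemma h_elt_in_finA: "1 \<le> p \<Longrightarrow> i \<le> n \<Longrightarrow> h_elt n p i \<in> finA n n"
  unfolding h_elt_def ascend_def descend_def
  by (intro subgroup.m_closed[OF finA_subgroup] gprod_in_subgroup[OF finA_subgroup])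
    (auto intro!: sigma_in_finA)

lemma finA_carrier: "k \<le> n + 1 \<Longrightarrow> x \<in> finA n k \<Longrightarrow> x \<in> carrier (affA n)"
  using subgroup.mem_carrier[OF finA_subgroup] .

lemma act_inv_h_elt:
  assumes "n \<ge> 2" "1 \<le> p" "p \<le> n + 1" "i \<le> n" "1 \<le> r" "r \<le> n + 1"
  shows "node_swap n (n + 1) (act n (inv\<^bsub>affA n\<^esub> h_elt n p i) (r, c)) = factor_move n p i (r, c)"
proof -
  interpret group "affA n" by (rule affA_group)
  have up: "set [p..<Suc n] \<subseteq> {1..n + 1}" and down: "set (rev [1..<Suc i]) \<subseteq> {1..n + 1}"
    using assms by auto
  have car: "ascend n p n \<in> carrier (affA n)" "descend n i \<in> carrier (affA n)"
    using assms ascend_closed[of p n n] unfolding descend_def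
    by (auto intro!: gprod_closed sigma_carrier simp del: upt_Suc)
  have "act n (inv\<^bsub>affA n\<^esub> h_elt n p i) (r, c)
      = fold (node_swap n) (rev [1..<Suc i]) (fold (node_swap n) [p..<Suc n] (r, c))"
    unfolding h_elt_def using car assms(1)
    by (simp add: inv_mult_group act_mult del: upt_Suc One_nat_def)
      (simp add: ascend_def descend_def act_inv_gprod[OF assms(1) up] act_inv_gprod[OF assms(1) down]
        del: upt_Suc One_nat_def)
  moreover define r' where "r' = (if r < p then r else if r = p then n + 1 else r - 1)"
  moreover have "fold (node_swap n) [p..<Suc n] (r, c) = (r', c)"
    unfolding r'_def using assms by (subst fold_node_swap_up) auto
  moreover have "1 \<le> r'"
    unfolding r'_def using assms by auto
  then have "fold (node_swap n) (rev [1..<Suc i]) (r', c)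
      = (if r' = i + 1 then 1 else if r' \<le> i then r' + 1 else r', c)"
    using assms(4) by (subst fold_node_swap_down) auto
  ultimately show ?thesis by (simp only: factor_move_def Let_def prod.case)
qed

section \<open>The image of the smaller affine group\<close>

lemma R_image_subgroup: "n \<ge> 2 \<Longrightarrow> subgroup (R_map n ` carrier (affA (n - 1))) (affA n)"
  using R_map_hom[of n] group_hom.img_is_subgroup[of "affA (n - 1)" "affA n" "R_map n"]
  by (simp add: group_hom_def group_hom_axioms_def affA_group)

lemma R_image_sigma:
  assumes "n \<ge> 2"
  shows "sigma n ` {1..n - 1} \<subseteq> R_map n ` carrier (affA (n - 1))"
proof
  fix g assume "g \<in> sigma n ` {1..n - 1}"
  then obtain l where l: "g = sigma n l" "1 \<le> l" "l \<le> n - 1" by auto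
  then have "g = R_map n (sigma (n - 1) l)" using R_map_sigma[OF assms] by simp
  then show "g \<in> R_map n ` carrier (affA (n - 1))"
    using l by (intro image_eqI) (auto intro!: sigma_carrier)
qed

lemma R_image_aff_gen:
  assumes "n \<ge> 2"
  shows "sigma n n \<otimes>\<^bsub>affA n\<^esub> aff_gen n \<otimes>\<^bsub>affA n\<^esub> sigma n n
    \<in> R_map n ` carrier (affA (n - 1))"
proof (rule image_eqI)
  show "sigma n n \<otimes>\<^bsub>affA n\<^esub> aff_gen n \<otimes>\<^bsub>affA n\<^esub> sigma n n = R_map n (aff_gen (n - 1))"
    using R_map_aff_gen[OF assms] by simp
  show "aff_gen (n - 1) \<in> carrier (affA (n - 1))"
    unfolding aff_gen_eq by (rule sigma_carrier) auto
qed

text \<open>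
  The generators \<open>\<sigma>\<^sub>1, \<dots>, \<sigma>\<^sub>n\<^sub>-\<^sub>1\<close> do not touch the last place of a sheet, and conjugation by \<open>\<sigma>\<^sub>n\<close>
  turns \<open>a\<^sub>n\<^sub>+\<^sub>1\<close> into the exchange of place \<open>n\<close> with the first place of the next sheet.
\<close>

lemma R_image_fixes:
  assumes n: "n \<ge> 2" and "g \<in> R_map n ` carrier (affA (n - 1))"
  shows "act n g (n + 1, c) = (n + 1, c)"
proof -
  interpret group "affA n" by (rule affA_group)
  interpret group_hom "affA (n - 1)" "affA n" "R_map n"
    using R_map_hom[OF n] by (simp add: group_hom_def group_hom_axioms_def affA_group)
  obtain v where v: "v \<in> carrier (affA (n - 1))" "g = R_map n v" using assms(2) by blast
  have "act n (R_map n v) (n + 1, c) = (n + 1, c)"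
    using v(1)
  proof (induction rule: affA_induct)
    case one
    then show ?case using n hom_one by (simp add: act_one del: One_nat_def)
  next
    case (mult k X)
    note car = sigma_carrier[of _ n]
    have "act n (R_map n (sigma (n - 1) k)) (n + 1, c) = (n + 1, c)"
    proof (cases "k = n")
      case True
      then have "R_map n (sigma (n - 1) k) = sigma n n \<otimes>\<^bsub>affA n\<^esub> sigma n (n + 1) \<otimes>\<^bsub>affA n\<^esub> sigma n n"
        using R_map_aff_gen[of n] n by (simp add: aff_gen_eq)
      then show ?thesis
        using n car by (simp add: act_mult act_sigma) (simp add: node_swap_pair)
    next
      case False
      then have "R_map n (sigma (n - 1) k) = sigma n k" "k < n"
        using R_map_sigma[of n k] mult.hyps n by auto
      then show ?thesis
        using n mult.hyps by (simp add: act_sigma) (simp add: node_swap_pair)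
    qed
    then show ?case
      using mult n sigma_carrier[of k "n - 1"] by (simp add: act_mult del: One_nat_def)
  qed
  then show ?thesis using v(2) by simp
qed

section \<open>The path of the last place under the factors of a canonical form\<close>

definition track :: "nat \<Rightarrow> (nat \<Rightarrow> nat) \<Rightarrow> (nat \<Rightarrow> nat) \<Rightarrow> nat \<Rightarrow> nat \<times> int" where
  "track n j i k = fold (\<lambda>s. factor_move n (j s) (i s)) [1..<Suc k] (n + 1, 0)"

lemma track_0: "track n j i 0 = (n + 1, 0)"
  by (simp add: track_def)

lemma track_Suc: "track n j i (Suc k) = factor_move n (j (Suc k)) (i (Suc k)) (track n j i k)"
  by (simp add: track_def)

lemma ineqs_bounds:
  assumes "n \<ge> 2" "pairwise_ineqs n m j i" "1 \<le> k" "k \<le> m"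
  shows "1 \<le> j k" "j k \<le> n + 1" "i k < n" "k \<ge> 2 \<Longrightarrow> j k \<le> n" "k \<ge> 2 \<Longrightarrow> i k = 0 \<Longrightarrow> j k = 1"
proof -
  have "1 \<le> j k \<and> j k \<le> n + 1 \<and> i k < n \<and> (k \<ge> 2 \<longrightarrow> j k \<le> n \<and> (i k = 0 \<longrightarrow> j k = 1))"
  proof (cases "k = 1")
    case True
    then show ?thesis using assms(1,2) unfolding pairwise_ineqs_def by auto
  next
    case False
    then show ?thesis
      using bspec[OF conjunct2[OF assms(2)[unfolded pairwise_ineqs_def]], of k] assms by auto
  qed
  then show "1 \<le> j k" "j k \<le> n + 1" "i k < n" "k \<ge> 2 \<Longrightarrow> j k \<le> n" "k \<ge> 2 \<Longrightarrow> i k = 0 \<Longrightarrow> j k = 1"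
    by auto
qed

lemma ineqs_step:
  assumes "pairwise_ineqs n m j i" "1 \<le> k" "Suc k \<le> m"
  shows "j (Suc k) \<le> j k" "i k \<le> i (Suc k)" "j k > i k + 1 \<Longrightarrow> j (Suc k) < j k"
    "j (Suc k) > i (Suc k) + 1 \<Longrightarrow> i k < i (Suc k)"
  using bspec[OF conjunct2[OF assms(1)[unfolded pairwise_ineqs_def]], of "Suc k"] assms(2,3)
  by auto

text \<open>
  Once the place has moved up to a later sheet it stays in the initial segment \<open>1, \<dots>, i\<^sub>k + 1\<close> or moves
  up again, so it never comes back. Moving down would need \<open>r = i\<^sub>k\<^sub>+\<^sub>1 + 1\<close> and \<open>r < j\<^sub>k\<^sub>+\<^sub>1\<close>. But
  \<open>j\<^sub>k\<^sub>+\<^sub>1 > i\<^sub>k\<^sub>+\<^sub>1 + 1\<close> forces \<open>i\<^sub>k < i\<^sub>k\<^sub>+\<^sub>1\<close>, against \<open>r \<le> i\<^sub>k + 1\<close>.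
\<close>

lemma track_positive_sheet:
  assumes n: "n \<ge> 2" "pairwise_ineqs n m j i" and k: "1 \<le> k" "k \<le> k'" "k' \<le> m"
    and start: "track n j i k = (r, c)" "1 \<le> r" "r \<le> i k + 1" "c > 0"
  shows "\<exists>r c. track n j i k' = (r, c) \<and> 1 \<le> r \<and> r \<le> i k' + 1 \<and> c > 0"
  using k(2,3)
proof (induction k' rule: dec_induct)
  case base
  then show ?case using start by blast
next
  case (step l)
  then obtain r c where rc: "track n j i l = (r, c)" "1 \<le> r" "r \<le> i l + 1" "c > 0" by auto
  have l: "1 \<le> l" "Suc l \<le> m" using step k by auto
  note b = ineqs_bounds[OF n, of "Suc l"] and s = ineqs_step[OF n(2) l]
  have "j (Suc l) \<le> n" "1 \<le> j (Suc l)" "i (Suc l) < n" "i (Suc l) = 0 \<Longrightarrow> j (Suc l) = 1" using b l by auto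
  then show ?case using rc s
    unfolding track_Suc rc(1) factor_move_def node_swap_pair Let_def
    by (auto split: if_splits)
qed

text \<open>
  The mirror image: on an earlier sheet the place stays above all later \<open>j\<^sub>k\<close>, and a place moves up
  only from \<open>r = j\<^sub>k\<close>. The borderline \<open>r = j\<^sub>k\<close> is allowed by the invariant only when
  \<open>j\<^sub>k > i\<^sub>k + 1\<close>, and then the pairwise inequalities make \<open>j\<^sub>k\<^sub>+\<^sub>1\<close> strictly smaller.
\<close>

lemma track_negative_sheet:
  assumes n: "n \<ge> 2" "pairwise_ineqs n m j i" and k: "1 \<le> k" "k \<le> k'" "k' \<le> m"
    and start: "track n j i k = (r, c)" "r \<le> n + 1" "j k \<le> r" "j k \<le> i k + 1 \<Longrightarrow> j k < r" "c < 0"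
  shows "\<exists>r c. track n j i k' = (r, c) \<and> r \<le> n + 1 \<and> j k' \<le> r \<and> (j k' \<le> i k' + 1 \<longrightarrow> j k' < r) \<and> c < 0"
  using k(2,3)
proof (induction k' rule: dec_induct)
  case base
  then show ?case using start by blast
next
  case (step l)
  then obtain r c where rc: "track n j i l = (r, c)" "r \<le> n + 1" "j l \<le> r"
      "j l \<le> i l + 1 \<longrightarrow> j l < r" "c < 0" by auto
  have l: "1 \<le> l" "Suc l \<le> m" using step k by auto
  note b = ineqs_bounds[OF n, of "Suc l"] and s = ineqs_step[OF n(2) l]
  have "j (Suc l) \<le> n" "1 \<le> j (Suc l)" "i (Suc l) < n" using b l by auto
  moreover have "j (Suc l) < r" using rc s by linarith
  ultimately show ?case using rc
    unfolding track_Suc rc(1) factor_move_def node_swap_pair Let_def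
    by (auto split: if_splits)
qed

lemma ineqs_mono:
  assumes "pairwise_ineqs n m j i" "1 \<le> k" "k \<le> k'" "k' \<le> m"
  shows "i k \<le> i k'"
  using assms(3,4)
proof (induction k' rule: dec_induct)
  case (step l)
  then show ?case using ineqs_step(2)[OF assms(1), of l] assms(2) by simp
qed simp

text \<open>
  As long as \<open>k + i\<^sub>k < n\<close>, the place lies above \<open>j\<^sub>k\<close>, so the first cycle of the factor lowers it by
  one, and the lowered place \<open>n - k + 1\<close> is still above \<open>i\<^sub>k + 1\<close>, out of reach of the second cycle.
  The bound on \<open>j\<^sub>k\<close> passes on to \<open>k + 1\<close> because \<open>j\<close> decreases strictly unless it is at most \<open>i\<^sub>k + 1\<close>. Since \<open>i\<close> is monotone, the condition at \<open>s\<close> gives it for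
  every \<open>k \<le> s\<close>.
\<close>

lemma track_descent:
  assumes n: "n \<ge> 2" "pairwise_ineqs n m j i" and j1: "j 1 \<le> n"
    and s: "s \<le> m" "s + i s < n" and k: "1 \<le> k" "k \<le> s"
  shows "track n j i k = (n - k + 1, 0) \<and> j k \<le> n - k + 1"
  using k
proof (induction k rule: dec_induct)
  case base
  have "i 1 \<le> i s" using ineqs_mono[OF n(2), of 1 s] k s by simp
  then show ?case using j1 n s k unfolding One_nat_def track_Suc track_0
    by (auto simp: factor_move_def node_swap_pair Let_def)
next
  case (step l)
  have l: "1 \<le> l" "Suc l \<le> m" using step s by auto
  have "i l \<le> i s" "i (Suc l) \<le> i s" using ineqs_mono[OF n(2)] step s l by auto
  moreover have "j (Suc l) < n - l + 1"
    using ineqs_step(1,3)[OF n(2) l] step calculation s by linarith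
  moreover have "track n j i l = (n - l + 1, 0)" using step by simp
  ultimately show ?case using step s unfolding track_Suc
    by (auto simp: factor_move_def node_swap_pair Let_def)
qed

lemma ineqs_next_j:
  assumes n: "n \<ge> 2" "pairwise_ineqs n m j i" and j1: "j 1 \<le> n"
    and s: "1 \<le> s" "Suc s \<le> m" "s + i s < n"
  shows "j (Suc s) < n - s + 1"
  using track_descent[OF n j1 _ s(3), of s] ineqs_step(1,3)[OF n(2) s(1,2)] s by linarith

text \<open>
  When the place has come down into the range of the second cycle without meeting \<open>i\<^sub>k + 1\<close>, that cycle
  undoes the lowering by the first one. Monotonicity of \<open>i\<close> and \<open>j\<close> keeps it so for all later factors.
\<close>

lemma track_plateau:
  assumes n: "n \<ge> 2" "pairwise_ineqs n m j i" and j1: "j 1 \<le> n"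
    and s: "1 \<le> s" "Suc s \<le> m" "s + i s < n" "n \<le> s + i (Suc s)" and k: "s \<le> k" "k \<le> m"
  shows "track n j i k = (n - s + 1, 0)"
  using k
proof (induction k rule: dec_induct)
  case base
  then show ?case using track_descent[OF n j1 _ s(3), of s] s by simp
next
  case (step l)
  have "i (Suc s) \<le> i (Suc l)" using ineqs_mono[OF n(2), of "Suc s" "Suc l"] step by simp
  moreover have "j (Suc l) \<le> j (Suc s)"
    using step(1,4)
  proof (induction l rule: dec_induct)
    case (step l)
    then show ?case using ineqs_step(1)[OF n(2), of "Suc l"] by simp
  qed simp
  moreover have "j (Suc s) < n - s + 1" by (rule ineqs_next_j[OF n j1 s(1-3)])
  ultimately show ?case using step s unfolding track_Suc
    by (auto simp: factor_move_def node_swap_pair Let_def)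
qed

lemma track_inside:
  assumes n: "n \<ge> 2" "pairwise_ineqs n m j i" and j1: "j 1 \<le> n"
    and s: "1 \<le> s" "s \<le> m" "s + i s < n" "s < m \<Longrightarrow> n \<le> s + i (Suc s)" and k: "k \<le> m"
  shows "track n j i k = (n - min k s + 1, 0)"
proof -
  consider "k = 0" | "1 \<le> k" "k \<le> s" | "s < k" by linarith
  then show ?thesis
  proof cases
    case 1
    then show ?thesis by (simp add: track_0)
  next
    case 2
    then show ?thesis using track_descent[OF n j1 s(2,3)] by simp
  next
    case 3
    then show ?thesis using track_plateau[OF n j1 s(1) _ s(3), of k] s(4) k by simp
  qed
qed

lemma track_outside_start:
  assumes n: "n \<ge> 2" "pairwise_ineqs n m j i" and m: "m \<ge> 1"
    and "\<not> (j 1 \<le> n \<and> i 1 < n - 1)"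
  shows "snd (track n j i m) \<noteq> 0"
proof (cases "j 1 \<le> n")
  case True
  then have "i 1 = n - 1" using assms ineqs_bounds[OF n, of 1] by auto
  then have "track n j i 1 = (n + 1, - 1)"
    using True n unfolding One_nat_def track_Suc track_0
    by (auto simp: factor_move_def node_swap_pair Let_def)
  then show ?thesis using track_negative_sheet[OF n _ m, of "n + 1" "- 1"] True by force
next
  case False
  then have "j 1 = n + 1" "i 1 < n" using ineqs_bounds[OF n, of 1] m by auto
  then have "track n j i 1 = (1, 1)"
    using n unfolding One_nat_def track_Suc track_0
    by (auto simp: factor_move_def node_swap_pair Let_def)
  then show ?thesis using track_positive_sheet[OF n _ m, of 1 1] by force
qed

text \<open>
  If instead the lowered place is exactly \<open>i\<^sub>s\<^sub>+\<^sub>1 + 1\<close>, it is sent to the beginning of the sheet and across to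
  the previous sheet.
\<close>

lemma track_outside_exit:
  assumes n: "n \<ge> 2" "pairwise_ineqs n m j i" and j1: "j 1 \<le> n"
    and s: "1 \<le> s" "Suc s \<le> m" "s + i s < n" "Suc s + i (Suc s) = n"
  shows "snd (track n j i m) \<noteq> 0"
proof -
  have "track n j i s = (n - s + 1, 0)"
    using track_descent[OF n j1 _ s(3), of s] s by simp
  moreover have j: "j (Suc s) < n - s + 1" by (rule ineqs_next_j[OF n j1 s(1-3)])
  ultimately have "track n j i (Suc s) = (n + 1, - 1)"
    using s unfolding track_Suc by (auto simp: factor_move_def node_swap_pair Let_def)
  then show ?thesis
    using track_negative_sheet[OF n _ s(2), of "n + 1" "- 1"] j s by force
qed

section \<open>Reading the path in the group\<close>

definition canonical_prefix :: "nat \<Rightarrow> (nat \<Rightarrow> nat) \<Rightarrow> (nat \<Rightarrow> nat) \<Rightarrow> nat \<Rightarrow> nat list set" where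
  "canonical_prefix n j i k =
    gprod (affA n) (map (\<lambda>s. h_elt n (j s) (i s) \<otimes>\<^bsub>affA n\<^esub> aff_gen n) [1..<Suc k])"

lemma canonical_prefix_Suc:
  assumes "n \<ge> 2" "pairwise_ineqs n m j i" "Suc k \<le> m"
  shows "h_elt n (j (Suc k)) (i (Suc k)) \<in> finA n n"
    and "canonical_prefix n j i k \<in> carrier (affA n)"
    and "canonical_prefix n j i (Suc k) = canonical_prefix n j i k \<otimes>\<^bsub>affA n\<^esub>
      (h_elt n (j (Suc k)) (i (Suc k)) \<otimes>\<^bsub>affA n\<^esub> aff_gen n)"
proof -
  interpret group "affA n" by (rule affA_group)
  let ?f = "\<lambda>s. h_elt n (j s) (i s) \<otimes>\<^bsub>affA n\<^esub> aff_gen n"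
  have h: "h_elt n (j s) (i s) \<in> finA n n" if "1 \<le> s" "s \<le> m" for s
    using that ineqs_bounds[OF assms(1,2), of s] by (intro h_elt_in_finA) auto
  then have f: "?f s \<in> carrier (affA n)" if "1 \<le> s" "s \<le> m" for s
    using that finA_carrier[of n n] sigma_carrier[of "n + 1" n] by (simp add: aff_gen_eq)
  then have set: "set (map ?f [1..<Suc k]) \<subseteq> carrier (affA n)"
    using assms(3) by auto
  show "h_elt n (j (Suc k)) (i (Suc k)) \<in> finA n n" using h assms(3) by simp
  show "canonical_prefix n j i k \<in> carrier (affA n)"
    unfolding canonical_prefix_def by (rule gprod_closed[OF set])
  show "canonical_prefix n j i (Suc k) = canonical_prefix n j i k \<otimes>\<^bsub>affA n\<^esub> ?f (Suc k)"
    using gprod_append[OF set, of "[?f (Suc k)]"] f[of "Suc k"] assms(3)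
    by (simp add: canonical_prefix_def gprod_def)
qed

lemma track_range:
  assumes n: "n \<ge> 2" "pairwise_ineqs n m j i" and "k \<le> m"
  shows "1 \<le> fst (track n j i k) \<and> fst (track n j i k) \<le> n + 1"
  using assms(3)
proof (induction k)
  case 0
  then show ?case by (simp add: track_0)
next
  case (Suc k)
  obtain r c where "track n j i k = (r, c)" by fastforce
  then show ?case
    using Suc ineqs_bounds[OF n, of "Suc k"] unfolding track_Suc
    by (auto simp: factor_move_def node_swap_pair Let_def)
qed

lemma act_inv_canonical_prefix:
  assumes n: "n \<ge> 2" "pairwise_ineqs n m j i" and "k \<le> m"
  shows "canonical_prefix n j i k \<in> carrier (affA n) \<and>
    act n (inv\<^bsub>affA n\<^esub> canonical_prefix n j i k) (n + 1, 0) = track n j i k"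
  using assms(3)
proof (induction k)
  case 0
  interpret group "affA n" by (rule affA_group)
  show ?case using n by (simp add: canonical_prefix_def gprod_def track_0 act_one)
next
  case (Suc k)
  interpret group "affA n" by (rule affA_group)
  let ?h = "h_elt n (j (Suc k)) (i (Suc k))"
  note step = canonical_prefix_Suc[OF n Suc.prems]
  have car: "?h \<in> carrier (affA n)" "aff_gen n \<in> carrier (affA n)"
    using step(1) finA_carrier[of n n] by (auto simp: aff_gen_eq intro: sigma_carrier)
  obtain r c where rc: "track n j i k = (r, c)" by fastforce
  have r: "1 \<le> r" "r \<le> n + 1" using track_range[OF n, of k] Suc.prems rc by auto
  have "inv\<^bsub>affA n\<^esub> (canonical_prefix n j i (Suc k))
      = sigma n (n + 1) \<otimes>\<^bsub>affA n\<^esub> (inv\<^bsub>affA n\<^esub> ?h \<otimes>\<^bsub>affA n\<^esub> inv\<^bsub>affA n\<^esub> canonical_prefix n j i k)"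
    using step(2,3) car by (simp add: inv_mult_group m_assoc aff_gen_eq sigma_inv)
  then have "act n (inv\<^bsub>affA n\<^esub> canonical_prefix n j i (Suc k)) (n + 1, 0)
      = node_swap n (n + 1) (act n (inv\<^bsub>affA n\<^esub> ?h) (r, c))"
    using Suc rc step(2) car n sigma_carrier[of "n + 1" n] by (simp add: act_mult act_sigma)
  also have "\<dots> = track n j i (Suc k)"
    unfolding track_Suc rc using ineqs_bounds[OF n, of "Suc k"] Suc.prems r n
    by (intro act_inv_h_elt) auto
  finally show ?case using step(2,3) car by simp
qed

text \<open>
  While the path stays on sheet \<open>0\<close> no affine generator has acted at an end of the sheet. Each factor
  then moves the coset label of the prefix by relations of the group alone, and the label is the
  current place.
\<close>

lemma canonical_prefix_coset:
  assumes n: "n \<ge> 2" "pairwise_ineqs n m j i" and "k \<le> m"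
    and "\<And>l. l \<le> k \<Longrightarrow> snd (track n j i l) = 0"
  shows "canonical_prefix n j i k \<otimes>\<^bsub>affA n\<^esub> ascend n (fst (track n j i k)) n
    \<in> R_map n ` carrier (affA (n - 1))" (is "_ \<in> ?H")
  using assms(3,4)
proof (induction k)
  case 0
  interpret group "affA n" by (rule affA_group)
  show ?case
    using subgroup.one_closed[OF R_image_subgroup[OF n(1)]]
    by (simp add: canonical_prefix_def gprod_def track_0 ascend_empty)
next
  case (Suc k)
  interpret group "affA n" by (rule affA_group)
  let ?u = "canonical_prefix n j i k" and ?h = "h_elt n (j (Suc k)) (i (Suc k))"
  note step = canonical_prefix_Suc[OF n Suc.prems(1)]
  note H = R_image_subgroup[OF n(1)]
  have hc: "?h \<in> carrier (affA n)" and a: "aff_gen n \<in> carrier (affA n)"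
    using step(1) finA_carrier[of n n] by (auto simp: aff_gen_eq intro: sigma_carrier)
  obtain r where r: "track n j i k = (r, 0)" using Suc.prems(2)[of k] by (metis le_SucI order_refl prod.collapse)
  have rb: "1 \<le> r" "r \<le> n + 1" using track_range[OF n, of k] Suc.prems r by auto
  have IH: "?u \<otimes>\<^bsub>affA n\<^esub> ascend n r n \<in> ?H" using Suc r by simp
  obtain q where q: "act n (inv\<^bsub>affA n\<^esub> ?h) (r, 0) = (q, 0)" "1 \<le> q" "q \<le> n + 1"
    "?u \<otimes>\<^bsub>affA n\<^esub> inv\<^bsub>affA n\<^esub> (inv\<^bsub>affA n\<^esub> ?h) \<otimes>\<^bsub>affA n\<^esub> ascend n q n \<in> ?H"
    using coset_finA[OF n(1) H R_image_sigma[OF n(1)] _ step(2) rb IH]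
      subgroup.m_inv_closed[OF finA_subgroup step(1)] by (metis le_add1)
  have "track n j i (Suc k) = node_swap n (n + 1) (q, 0)"
    unfolding track_Suc r q(1)[symmetric] using ineqs_bounds[OF n, of "Suc k"] Suc.prems rb n
    by (intro act_inv_h_elt[symmetric]) auto
  \<comment> \<open>A place at an end of the sheet would be carried off sheet 0.\<close>
  with Suc.prems(2)[of "Suc k"] q have "track n j i (Suc k) = (q, 0)" "2 \<le> q" "q \<le> n"
    by (auto simp: node_swap_pair split: if_splits)
  moreover have "?u \<otimes>\<^bsub>affA n\<^esub> (?h \<otimes>\<^bsub>affA n\<^esub> aff_gen n) \<otimes>\<^bsub>affA n\<^esub> ascend n q n
      = ?u \<otimes>\<^bsub>affA n\<^esub> ?h \<otimes>\<^bsub>affA n\<^esub> ascend n q n \<otimes>\<^bsub>affA n\<^esub>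
        (sigma n n \<otimes>\<^bsub>affA n\<^esub> aff_gen n \<otimes>\<^bsub>affA n\<^esub> sigma n n)"
    using calculation aff_gen_ascend[of q n] step(2) hc a ascend_closed[of q n n] sigma_carrier[of n n] q
    by (simp add: m_assoc)
  moreover have "\<dots> \<in> ?H"
    using subgroup.m_closed[OF H q(4) R_image_aff_gen[OF n(1)]] hc by simp
  ultimately show ?case using step(3) by simp
qed

text \<open>
  If \<open>u x\<close> fixes the place \<open>n + 1\<close>, then \<open>u\<inverse>\<close> and \<open>x\<close> agree on it.
\<close>

lemma track_eq_act_of_image:
  assumes n: "n \<ge> 2" "pairwise_ineqs n m j i" and x: "x \<in> carrier (affA n)"
    and image: "canonical_prefix n j i m \<otimes>\<^bsub>affA n\<^esub> x \<in> R_map n ` carrier (affA (n - 1))"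
  shows "track n j i m = act n x (n + 1, 0)"
proof -
  let ?u = "canonical_prefix n j i m"
  have u: "?u \<in> carrier (affA n)" "act n (inv\<^bsub>affA n\<^esub> ?u) (n + 1, 0) = track n j i m"
    using act_inv_canonical_prefix[OF n] by auto
  have "act n ?u (act n x (n + 1, 0)) = (n + 1, 0)"
    using R_image_fixes[OF n(1) image, of 0] act_mult[OF n(1) u(1) x] by simp
  then show ?thesis
    using act_inv_act[OF n(1) u(1), of "act n x (n + 1, 0)"] u(2) by simp
qed

text \<open>
  The decomposition \<open>x = \<lfloor>p, n\<rfloor> y\<close> with \<open>y \<in> W(A\<^sub>n\<^sub>-\<^sub>1)\<close>, with \<open>p\<close> read off the action: this is the
  coset label of \<open>x\<inverse>\<close> for the subgroup \<open>W(A\<^sub>n\<^sub>-\<^sub>1)\<close>.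
\<close>

lemma finA_coset:
  assumes n: "n \<ge> 2" and x: "x \<in> finA n n"
  obtains p y where "act n x (n + 1, 0) = (p, 0)" "1 \<le> p" "p \<le> n + 1"
    "y \<in> finA n (n - 1)" "x = ascend n p n \<otimes>\<^bsub>affA n\<^esub> y"
proof -
  interpret group "affA n" by (rule affA_group)
  let ?K = "finA n (n - 1)"
  have K: "subgroup ?K (affA n)" by (rule finA_subgroup) simp
  have s: "sigma n ` {1..n - 1} \<subseteq> ?K" by (auto intro: sigma_in_finA)
  have start: "\<one>\<^bsub>affA n\<^esub> \<otimes>\<^bsub>affA n\<^esub> ascend n (n + 1) n \<in> ?K"
    using subgroup.one_closed[OF K] by (simp add: ascend_empty)
  obtain p where p: "act n x (n + 1, 0) = (p, 0)" "1 \<le> p" "p \<le> n + 1"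
    and xK: "\<one>\<^bsub>affA n\<^esub> \<otimes>\<^bsub>affA n\<^esub> inv\<^bsub>affA n\<^esub> x \<otimes>\<^bsub>affA n\<^esub> ascend n p n \<in> ?K"
    by (rule coset_finA[OF n K s x one_closed _ _ start, of 0]) auto
  have car: "x \<in> carrier (affA n)" "ascend n p n \<in> carrier (affA n)"
    using finA_carrier[OF _ x] ascend_closed[OF p(2)] by auto
  have "inv\<^bsub>affA n\<^esub> (inv\<^bsub>affA n\<^esub> x \<otimes>\<^bsub>affA n\<^esub> ascend n p n) \<in> ?K"
    using subgroup.m_inv_closed[OF K] xK car by simp
  moreover have "x = ascend n p n \<otimes>\<^bsub>affA n\<^esub> inv\<^bsub>affA n\<^esub> (inv\<^bsub>affA n\<^esub> x \<otimes>\<^bsub>affA n\<^esub> ascend n p n)"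
    using car by (simp add: inv_mult_group flip: m_assoc)
  ultimately show thesis using that p by blast
qed

theorem corollary4p7:
  fixes n m :: nat and j i :: "nat \<Rightarrow> nat" and x w :: "nat list set"
  assumes "n \<ge> 2" and "m \<ge> 1"
    and "canonical_form n m j i x w"
  shows "w \<in> R_map n ` carrier (affA (n - 1)) \<longleftrightarrow>
    (j 1 \<le> n \<and> i 1 < n - 1) \<and>
    (let s = Max {k \<in> {1..m}. int n - int k - int (i k) > 0} in
      (s < m \<longrightarrow> int n - int (s + 1) - int (i (s + 1)) < 0) \<and>
      (\<exists>y \<in> finA n (n - 1). x = ascend n (n - s + 1) n \<otimes>\<^bsub>affA n\<^esub> y))"
proof -
  interpret group "affA n" by (rule affA_group)
  let ?H = "R_map n ` carrier (affA (n - 1))" and ?u = "canonical_prefix n j i m"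
  have ineqs: "pairwise_ineqs n m j i" and x: "x \<in> finA n n"
    and w: "w = ?u \<otimes>\<^bsub>affA n\<^esub> x"
    using assms(3) by (auto simp: canonical_form_def canonical_prefix_def)
  note n = assms(1) ineqs and H = R_image_subgroup[OF assms(1)]
  have u: "?u \<in> carrier (affA n)" using act_inv_canonical_prefix[OF n, of m] by simp
  have xc: "x \<in> carrier (affA n)" using finA_carrier[OF _ x] by simp
  obtain p y where p: "act n x (n + 1, 0) = (p, 0)"
    and y: "y \<in> finA n (n - 1)" "x = ascend n p n \<otimes>\<^bsub>affA n\<^esub> y"
    using finA_coset[OF assms(1) x] by metis
  have track_p: "track n j i m = (p, 0)" if "w \<in> ?H"
    using track_eq_act_of_image[OF n xc] that p w by simp
  show ?thesis
  proof (cases "j 1 \<le> n \<and> i 1 < n - 1")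
    case False
    then have "w \<notin> ?H" using track_outside_start[OF n assms(2)] track_p by force
    then show ?thesis using False by blast
  next
    case inside: True
    define S where "S = {k \<in> {1..m}. int n - int k - int (i k) > 0}"
    define s where "s = Max S"
    have S: "finite S" "1 \<in> S" using inside assms(2) by (auto simp: S_def)
    then have "s \<in> S" unfolding s_def by (intro Max_in) auto
    then have s: "1 \<le> s" "s \<le> m" "s + i s < n" by (auto simp: S_def)
    have "Suc s \<notin> S" using Max_ge[OF S(1), of "Suc s"] by (auto simp: s_def)
    then have s_max: "n \<le> Suc s + i (Suc s)" if "s < m" using that by (auto simp: S_def)
    have "w \<in> ?H \<longleftrightarrow> (s < m \<longrightarrow> int n - int (s + 1) - int (i (s + 1)) < 0) \<and>
      (\<exists>y \<in> finA n (n - 1). x = ascend n (n - s + 1) n \<otimes>\<^bsub>affA n\<^esub> y)"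
    proof (intro iffI conjI)
      assume "w \<in> ?H"
      note tr = track_p[OF this]
      show cond: "s < m \<longrightarrow> int n - int (s + 1) - int (i (s + 1)) < 0"
      proof
        assume "s < m"
        then have "Suc s + i (Suc s) \<noteq> n"
          using track_outside_exit[OF n conjunct1[OF inside] s(1) _ s(3)] tr by auto
        then show "int n - int (s + 1) - int (i (s + 1)) < 0"
          using s_max[OF \<open>s < m\<close>] by simp
      qed
      have "n \<le> s + i (Suc s)" if "s < m" using cond that by simp
      then have "track n j i m = (n - s + 1, 0)"
        using track_inside[OF n conjunct1[OF inside] s, of m] s(2) by (simp add: min_absorb2)
      then show "\<exists>y \<in> finA n (n - 1). x = ascend n (n - s + 1) n \<otimes>\<^bsub>affA n\<^esub> y"
        using tr y by auto
    next
      assume rhs: "(s < m \<longrightarrow> int n - int (s + 1) - int (i (s + 1)) < 0) \<and>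
        (\<exists>y \<in> finA n (n - 1). x = ascend n (n - s + 1) n \<otimes>\<^bsub>affA n\<^esub> y)"
      then obtain y where y: "y \<in> finA n (n - 1)" "x = ascend n (n - s + 1) n \<otimes>\<^bsub>affA n\<^esub> y"
        by blast
      have "n \<le> s + i (Suc s)" if "s < m" using rhs that by simp
      then have track: "track n j i k = (n - min k s + 1, 0)" if "k \<le> m" for k
        using track_inside[OF n conjunct1[OF inside] s _ that] by simp
      have "?u \<otimes>\<^bsub>affA n\<^esub> ascend n (n - s + 1) n \<in> ?H"
        using canonical_prefix_coset[OF n order_refl] track s(2) by (simp add: min_absorb2)
      moreover have "y \<in> ?H"
        using y(1) generate_subgroup_incl[OF R_image_sigma[OF assms(1)] H]
        unfolding finA_def by blast
      ultimately have "?u \<otimes>\<^bsub>affA n\<^esub> ascend n (n - s + 1) n \<otimes>\<^bsub>affA n\<^esub> y \<in> ?H"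
        by (rule subgroup.m_closed[OF H])
      moreover have "y \<in> carrier (affA n)" using finA_carrier[OF _ y(1)] by simp
      moreover have "ascend n (n - s + 1) n \<in> carrier (affA n)"
        using s by (intro ascend_closed) auto
      ultimately show "w \<in> ?H"
        unfolding w y(2) using u by (simp add: m_assoc)
    qed
    then show ?thesis using inside by (simp add: s_def S_def Let_def)
  qed
qed

end
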